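(* Let $n,k,s$ be integers and let $G$ be a graph on $n$ vertices. (i) Suppose that $n\ge \max\{2k,\,2k+1-s\}$ and $\delta(G)\ge k\ge \max\{s,1\}$. If $\rho(\overline{G})\le \sqrt{(k-s)(n-k-1)}$, then at least one of the following holds: $\mathscr{C}_{n+s}(G)=K_n$; or $G\in \mathbb{B}_{n,k,s,r}\cup \mathbb{H}_{n,k,s,r}$ for some $r$; or both $s=k-1$ and $G=\overline{K_{1,k-1}}\vee\overline{K_{1,k-1}}$. (ii) Suppose that $n\ge 3s+2$. If $\mu(\overline{G})\le n-s-1$, then either $\mathscr{C}_{n+s}(G)=K_n$, or $G\in \mathbb{C}_{n,s,r}\cup\mathbb{D}_{n,s,r}\cup\mathbb{W}_{n,s,r}$ for some $r$.
   Context: All graphs are finite, simple and undirected; equality of (or membership among) graphs is understood up to isomorphism. $\overline{G}$ is the complement and $\delta(G)$ the minimum degree of $G$. $A(G)$ is the adjacency matrix, $D(G)$ the diagonal degree matrix; $\rho(G)$ is the largest eigenvalue of $A(G)$ and $\mu(G)$ is the largest eigenvalue of $Q(G)=D(G)+A(G)$. The join $G\vee H$ of disjoint graphs is obtained from $G\cup H$ by adding all edges between $V(G)$ and $V(H)$; $K_0$ is the graph with no vertices, and conditions on it are regarded as vacuously true. Closure: for an integer $\ell$, $\mathscr{C}_{\ell}(G)$ is the graph obtained from $G$ by recursively joining pairs of nonadjacent vertices whose degree sum (in the current graph) is at least $\ell$ until no such pair remains nonadjacent. A $(p,q)$-semi-regular bipartite graph is a bipartite graph with vertex bipartition $(U,V)$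 in which every vertex of $U$ has degree $p$ and every vertex of $V$ has degree $q$. Graph families (each is empty when its index conditions fail): - $\mathbb{B}_{n,k,s,r}$ ($0\le r\le s+1$, $r\ne 1$): all graphs $\overline{G_1}\vee G_2$ where $G_1$ is a connected $(k-s,n-k-1)$-semi-regular bipartite graph with $n-s-1+r$ vertices and $G_2$ is a spanning subgraph of $K_{s+1-r}$. - $\mathbb{H}_{n,k,s,r}$ (defined when $n=2k+1-s$ and $s\le 1$; $0\le r\le k$): all graphs $G_1\vee G_2$ where $G_1$ is an $r$-regular graph with $n-k+r$ vertices and $G_2$ is a spanning subgraph of $K_{k-r}$. - $\mathbb{C}_{n,s,r}$ ($0\le r\le s+1$, $r\neq 1$): all graphs $\overline{G_1}\vee G_2$ where, for some integer $p$ with $1\le p\le \frac{n-s-1}{2}$, $G_1$ is a connected $(p,n-s-1-p)$-semi-regular bipartite graph with $n-s-1+r$ vertices and $G_2$ is a spanning subgraph of $K_{s+1-r}$. - $\mathbb{D}_{n,s,r}$ ($0\le r\le s-1$): all graphs $(\overline{G_1}\vee\overline{G_2})\vee G_3$ where $G_1,G_2$ are two connected $\frac{n-s-1}{2}$-regular graphs with $|V(G_1)|+|V(G_2)|=n-r$ and $G_3$ is a spanning subgraph of $K_r$ with $\mu(\overline{G_3})\le n-s-1$. - $\mathbb{W}_{n,s,r}$ ($0\le r\le \frac{n+s-1}{2}$): all graphs $\overline{G_1}\vee G_2$ where $G_1$ is a connected $\frac{n-s-1}{2}$-regular graph with $n-r$ vertices and $G_2$ is a spanning subgraph of $K_r$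 with $\mu(\overline{G_2})\le n-s-1$. *)

theory Defs
  imports
    "Graph_Theory.Kuratowski"
    "Graph_Theory.Digraph_Isomorphism"
    "Jordan_Normal_Form.Spectral_Radius"
begin

text \<open>
  Finite simple graphs are the \<^locale>\<open>pair_graph\<close>s of the Graph Theory entry (an edge is a
  pair of opposite arcs).  Isomorphism, connectedness, spanning subgraphs, complete and complete
  bipartite graphs are the notions of that entry.  Parameters that range over the integers
  in the mathematics (and may be negative) have type \<^typ>\<open>int\<close>.
\<close>

section \<open>Graph operations\<close>

definition vdeg :: "'a pair_pre_digraph \<Rightarrow> 'a \<Rightarrow> nat" where
  "vdeg G v = out_degree (with_proj G) v"

definition min_degree :: "'a pair_pre_digraph \<Rightarrow> nat" where
  "min_degree G = Min (vdeg G ` pverts G)"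

definition graph_complement :: "'a pair_pre_digraph \<Rightarrow> 'a pair_pre_digraph" where
  "graph_complement G = \<lparr> pverts = pverts G,
     parcs = {(u, v). u \<in> pverts G \<and> v \<in> pverts G \<and> u \<noteq> v \<and> (u, v) \<notin> parcs G} \<rparr>"

text \<open>Only meaningful for graphs with disjoint vertex sets; all uses below ensure this.\<close>

definition graph_join :: "'a pair_pre_digraph \<Rightarrow> 'a pair_pre_digraph \<Rightarrow> 'a pair_pre_digraph" where
  "graph_join G H = \<lparr> pverts = pverts G \<union> pverts H,
     parcs = parcs G \<union> parcs H \<union> pverts G \<times> pverts H \<union> pverts H \<times> pverts G \<rparr>"

abbreviation graph_iso :: "'a pair_pre_digraph \<Rightarrow> 'b pair_pre_digraph \<Rightarrow> bool" where
  "graph_iso G H \<equiv> digraph_iso (with_proj G) (with_proj H)"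

section \<open>Spectra\<close>

text \<open>
  The matrices are taken with respect to an arbitrary enumeration of the vertices; another
  enumeration gives a matrix that is similar by a permutation, hence has the same spectrum.
\<close>

definition vertex_list :: "'a pair_pre_digraph \<Rightarrow> 'a list" where
  "vertex_list G = (SOME xs. distinct xs \<and> set xs = pverts G)"

definition adjacency_matrix :: "'a pair_pre_digraph \<Rightarrow> real mat" where
  "adjacency_matrix G = (let xs = vertex_list G; n = length xs in
     mat n n (\<lambda>(i, j). if (xs ! i, xs ! j) \<in> parcs G then 1 else 0))"

definition degree_matrix :: "'a pair_pre_digraph \<Rightarrow> real mat" where
  "degree_matrix G = (let xs = vertex_list G; n = length xs in
     mat n n (\<lambda>(i, j). if i = j then real (vdeg G (xs ! i)) else 0))"

definition signless_laplacian :: "'a pair_pre_digraph \<Rightarrow> real mat" where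
  "signless_laplacian G = degree_matrix G + adjacency_matrix G"

text \<open>
  The matrices are real symmetric, so the real spectrum contains all eigenvalues and its maximum
  exists, except for the graph without vertices, where \<^const>\<open>Max\<close> is unspecified.
\<close>

definition graph_rho :: "'a pair_pre_digraph \<Rightarrow> real" where
  "graph_rho G = Max (spectrum (adjacency_matrix G))"

definition graph_mu :: "'a pair_pre_digraph \<Rightarrow> real" where
  "graph_mu G = Max (spectrum (signless_laplacian G))"

section \<open>Degree closure\<close>

definition closure_step :: "int \<Rightarrow> 'a pair_pre_digraph \<Rightarrow> 'a pair_pre_digraph \<Rightarrow> bool" where
  "closure_step l G H \<longleftrightarrow> (\<exists>u \<in> pverts G. \<exists>v \<in> pverts G. u \<noteq> v \<and> (u, v) \<notin> parcs G \<and>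
     int (vdeg G u) + int (vdeg G v) \<ge> l \<and>
     H = \<lparr> pverts = pverts G, parcs = parcs G \<union> {(u, v), (v, u)} \<rparr>)"

definition is_closure :: "int \<Rightarrow> 'a pair_pre_digraph \<Rightarrow> 'a pair_pre_digraph \<Rightarrow> bool" where
  "is_closure l G H \<longleftrightarrow> (closure_step l)\<^sup>*\<^sup>* G H \<and> (\<nexists>H'. closure_step l H H')"

definition degree_closure :: "int \<Rightarrow> 'a pair_pre_digraph \<Rightarrow> 'a pair_pre_digraph" where
  "degree_closure l G = (THE H. is_closure l G H)"

text \<open>The order in which edges are added is irrelevant, so the description is proper.\<close>

lemma closure_step_pair_graph:
  assumes "closure_step l G H" "pair_graph G"
  shows "pair_graph H"
proof -
  interpret pair_graph G by fact
  from assms(1) obtain u v where uv: "u \<in> pverts G" "v \<in> pverts G" "u \<noteq> v"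
    and H: "H = \<lparr> pverts = pverts G, parcs = parcs G \<union> {(u, v), (v, u)} \<rparr>"
    by (auto simp: closure_step_def)
  have "sym (parcs G)" using pair_sym_arcs by (simp add: symmetric_def)
  then show ?thesis unfolding H using uv pair_finite_verts pair_finite_arcs pair_no_loops
    by unfold_locales (auto simp: symmetric_def intro!: symI dest: symD in_arcsD1 in_arcsD2)
qed

lemma closure_step_pverts: "closure_step l G H \<Longrightarrow> pverts H = pverts G"
  by (auto simp: closure_step_def)

lemma closure_steps_pair_graph:
  assumes "(closure_step l)\<^sup>*\<^sup>* G H" "pair_graph G"
  shows "pair_graph H \<and> pverts H = pverts G"
  using assms(1)
proof (induction rule: rtranclp_induct)
  case base
  show ?case using assms(2) by simp
next
  case (step X Y)
  then show ?case
    using closure_step_pair_graph[OF step.hyps(2)] closure_step_pverts[OF step.hyps(2)] by metis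
qed

lemma vdeg_mono:
  assumes "pair_graph H" "parcs G \<subseteq> parcs H"
  shows "vdeg G u \<le> vdeg H u"
proof -
  interpret pair_graph H by fact
  show ?thesis using assms(2) pair_finite_arcs
    by (auto simp: vdeg_def out_degree_def out_arcs_def intro!: card_mono)
qed

lemma closure_steps_below:
  assumes "(closure_step l)\<^sup>*\<^sup>* G H" "pair_graph G" "is_closure l G K"
  shows "parcs H \<subseteq> parcs K"
  using assms(1)
proof (induction rule: rtranclp_induct)
  case base
  have "(closure_step l)\<^sup>*\<^sup>* G K" using assms(3) by (simp add: is_closure_def)
  then show ?case by (induction rule: rtranclp_induct) (auto simp: closure_step_def)
next
  case (step X Y)
  have K: "pair_graph K" "pverts K = pverts G"
    using closure_steps_pair_graph[of l G K] assms by (auto simp: is_closure_def)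
  have X: "pverts X = pverts G" using closure_steps_pair_graph[OF step.hyps(1)] assms by simp
  interpret K: pair_graph K by (rule K)
  from step.hyps(2) obtain u v where uv: "u \<in> pverts X" "v \<in> pverts X" "u \<noteq> v"
      "int (vdeg X u) + int (vdeg X v) \<ge> l"
    and Y: "Y = \<lparr> pverts = pverts X, parcs = parcs X \<union> {(u, v), (v, u)} \<rparr>"
    by (auto simp: closure_step_def)
  have deg: "int (vdeg K u) + int (vdeg K v) \<ge> l"
    using uv(4) vdeg_mono[OF K(1) step.IH, of u] vdeg_mono[OF K(1) step.IH, of v] by linarith
  have in_K: "u \<in> pverts K" "v \<in> pverts K" using uv(1,2) K(2) X by simp_all
  have "(u, v) \<in> parcs K"
  proof (rule ccontr)
    assume "(u, v) \<notin> parcs K"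
    then have "closure_step l K \<lparr> pverts = pverts K, parcs = parcs K \<union> {(u, v), (v, u)} \<rparr>"
      unfolding closure_step_def using uv(3) deg in_K by blast
    then show False using assms(3) unfolding is_closure_def by blast
  qed
  moreover have "sym (parcs K)" using K.pair_sym_arcs by (simp add: symmetric_def)
  ultimately have "(v, u) \<in> parcs K" by (blast dest: symD)
  then show ?case using step.IH \<open>(u, v) \<in> parcs K\<close> by (simp add: Y)
qed

lemma ex1_is_closure:
  assumes "pair_graph G"
  shows "\<exists>!H. is_closure l G H"
proof (rule ex_ex1I)
  show "\<exists>H. is_closure l G H"
    using assms
  proof (induction "card (pverts G \<times> pverts G - parcs G)" arbitrary: G rule: less_induct)
    case less
    interpret pair_graph G by (rule less.prems)
    show ?case
    proof (cases "\<exists>H'. closure_step l G H'")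
      case False
      then show ?thesis by (auto simp: is_closure_def)
    next
      case True
      then obtain H' where H': "closure_step l G H'" by blast
      then have "pverts H' \<times> pverts H' - parcs H' \<subset> pverts G \<times> pverts G - parcs G"
        by (auto simp: closure_step_def)
      then have "card (pverts H' \<times> pverts H' - parcs H') < card (pverts G \<times> pverts G - parcs G)"
        using pair_finite_verts by (intro psubset_card_mono) auto
      from less.hyps[OF this closure_step_pair_graph[OF H' less.prems]] obtain H
        where "is_closure l H' H" by blast
      then have "is_closure l G H"
        using H' by (auto simp: is_closure_def intro: converse_rtranclp_into_rtranclp)
      then show ?thesis ..
    qed
  qed
next
  fix H K
  assume H: "is_closure l G H" and K: "is_closure l G K"
  have "parcs H = parcs K"
    using closure_steps_below[of l G H K] closure_steps_below[of l G K H] assms H K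
    by (auto simp: is_closure_def)
  moreover have "pverts H = pverts K"
    using closure_steps_pair_graph[of l G H] closure_steps_pair_graph[of l G K] assms H K
    by (simp add: is_closure_def)
  ultimately show "H = K" by (intro pair_pre_digraph.equality) auto
qed

section \<open>Graph families\<close>

text \<open>
  Conditions on the graph without vertices count as vacuously true, whereas
  \<^const>\<open>connected\<close> excludes that graph and \<^const>\<open>graph_mu\<close> is unspecified on it.
\<close>

definition connected_graph :: "'a pair_pre_digraph \<Rightarrow> bool" where
  "connected_graph G \<longleftrightarrow> pverts G = {} \<or> connected (with_proj G)"

definition mu_at_most :: "'a pair_pre_digraph \<Rightarrow> int \<Rightarrow> bool" where
  "mu_at_most G c \<longleftrightarrow> pverts G = {} \<or> graph_mu G \<le> real_of_int c"

text \<open>The degree is a rational number: no nonempty graph is regular of fractional degree.\<close>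

definition regular_graph :: "rat \<Rightarrow> 'a pair_pre_digraph \<Rightarrow> bool" where
  "regular_graph d G \<longleftrightarrow> (\<forall>v \<in> pverts G. of_nat (vdeg G v) = d)"

definition semi_regular_bipartite :: "int \<Rightarrow> int \<Rightarrow> 'a pair_pre_digraph \<Rightarrow> bool" where
  "semi_regular_bipartite p q G \<longleftrightarrow> (\<exists>U V. pverts G = U \<union> V \<and> U \<inter> V = {} \<and>
     parcs G \<subseteq> U \<times> V \<union> V \<times> U \<and>
     (\<forall>u \<in> U. int (vdeg G u) = p) \<and> (\<forall>v \<in> V. int (vdeg G v) = q))"

definition spanning_subgraph_of_K :: "int \<Rightarrow> 'a pair_pre_digraph \<Rightarrow> bool" where
  "spanning_subgraph_of_K m G \<longleftrightarrow> m \<ge> 0 \<and> pair_graph G \<and>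
     (\<exists>K :: 'a pair_pre_digraph. complete_digraph (nat m) (with_proj K) \<and>
        spanning (with_proj G) (with_proj K))"

text \<open>
  The families consist of graphs with vertices in the given type; membership up to isomorphism is
  \<open>in_upto_iso\<close>.
\<close>

definition family_B :: "int \<Rightarrow> int \<Rightarrow> int \<Rightarrow> int \<Rightarrow> 'a pair_pre_digraph set" where
  "family_B n k s r = {graph_join (graph_complement G1) G2 | G1 G2.
     0 \<le> r \<and> r \<le> s + 1 \<and> r \<noteq> 1 \<and>
     pair_graph G1 \<and> connected_graph G1 \<and> semi_regular_bipartite (k - s) (n - k - 1) G1 \<and>
     int (card (pverts G1)) = n - s - 1 + r \<and>
     spanning_subgraph_of_K (s + 1 - r) G2 \<and>
     pverts G1 \<inter> pverts G2 = {}}"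

definition family_H :: "int \<Rightarrow> int \<Rightarrow> int \<Rightarrow> int \<Rightarrow> 'a pair_pre_digraph set" where
  "family_H n k s r = {graph_join G1 G2 | G1 G2.
     n = 2 * k + 1 - s \<and> s \<le> 1 \<and> 0 \<le> r \<and> r \<le> k \<and>
     pair_graph G1 \<and> regular_graph (of_int r) G1 \<and>
     int (card (pverts G1)) = n - k + r \<and>
     spanning_subgraph_of_K (k - r) G2 \<and>
     pverts G1 \<inter> pverts G2 = {}}"

definition family_C :: "int \<Rightarrow> int \<Rightarrow> int \<Rightarrow> 'a pair_pre_digraph set" where
  "family_C n s r = {graph_join (graph_complement G1) G2 | G1 G2.
     0 \<le> r \<and> r \<le> s + 1 \<and> r \<noteq> 1 \<and>
     pair_graph G1 \<and> connected_graph G1 \<and>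
     (\<exists>p. 1 \<le> p \<and> of_int p \<le> (of_int (n - s - 1) / 2 :: rat) \<and>
          semi_regular_bipartite p (n - s - 1 - p) G1) \<and>
     int (card (pverts G1)) = n - s - 1 + r \<and>
     spanning_subgraph_of_K (s + 1 - r) G2 \<and>
     pverts G1 \<inter> pverts G2 = {}}"

definition family_D :: "int \<Rightarrow> int \<Rightarrow> int \<Rightarrow> 'a pair_pre_digraph set" where
  "family_D n s r =
     {graph_join (graph_join (graph_complement G1) (graph_complement G2)) G3 | G1 G2 G3.
     0 \<le> r \<and> r \<le> s - 1 \<and>
     pair_graph G1 \<and> connected_graph G1 \<and> regular_graph (of_int (n - s - 1) / 2) G1 \<and>
     pair_graph G2 \<and> connected_graph G2 \<and> regular_graph (of_int (n - s - 1) / 2) G2 \<and>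
     int (card (pverts G1)) + int (card (pverts G2)) = n - r \<and>
     spanning_subgraph_of_K r G3 \<and> mu_at_most (graph_complement G3) (n - s - 1) \<and>
     pverts G1 \<inter> pverts G2 = {} \<and> (pverts G1 \<union> pverts G2) \<inter> pverts G3 = {}}"

definition family_W :: "int \<Rightarrow> int \<Rightarrow> int \<Rightarrow> 'a pair_pre_digraph set" where
  "family_W n s r = {graph_join (graph_complement G1) G2 | G1 G2.
     0 \<le> r \<and> of_int r \<le> (of_int (n + s - 1) / 2 :: rat) \<and>
     pair_graph G1 \<and> connected_graph G1 \<and> regular_graph (of_int (n - s - 1) / 2) G1 \<and>
     int (card (pverts G1)) = n - r \<and>
     spanning_subgraph_of_K r G2 \<and> mu_at_most (graph_complement G2) (n - s - 1) \<and>
     pverts G1 \<inter> pverts G2 = {}}"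

definition in_upto_iso :: "'a pair_pre_digraph \<Rightarrow> 'a pair_pre_digraph set \<Rightarrow> bool" where
  "in_upto_iso G F \<longleftrightarrow> (\<exists>H \<in> F. graph_iso G H)"

text \<open>Being \<open>K_n\<close> or \<open>K_{1,m}\<close> is already isomorphism invariant as defined in the library.\<close>

definition is_star_complement_join :: "int \<Rightarrow> 'a pair_pre_digraph \<Rightarrow> bool" where
  "is_star_complement_join k G \<longleftrightarrow> (\<exists>H1 H2 :: 'a pair_pre_digraph.
     complete_bipartite_digraph 1 (nat (k - 1)) (with_proj H1) \<and>
     complete_bipartite_digraph 1 (nat (k - 1)) (with_proj H2) \<and>
     pverts H1 \<inter> pverts H2 = {} \<and>
     graph_iso G (graph_join (graph_complement H1) (graph_complement H2)))"

end

theory Submission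
  imports Defs
begin

text \<open>
  Write \<open>L\<close> for the complement of \<open>G\<close> and \<open>c = n - s - 1\<close>. If the closure of \<open>G\<close> is not complete, its
  complement \<open>F\<close> is a subgraph of \<open>L\<close> on the same vertices with at least one edge, and since the closure process
  has stopped, the two ends of every edge of \<open>F\<close> have \<open>F\<close>-degrees with sum at least \<open>c\<close>.

  Such an \<open>F\<close> forces a large eigenvalue on \<open>L\<close>. For the signless Laplacian take the degree vector \<open>d\<close>
  of \<open>F\<close> as test vector: the form of \<open>L\<close> at \<open>d\<close> is a sum of \<open>(d u + d v)\<^sup>2\<close> over edges; it is at least the
  part over \<open>F\<close>, which is at least \<open>c\<close> times the sum of \<open>d u + d v\<close> over the edges of \<open>F\<close>, that is
  \<open>c\<close> times the squared norm of \<open>d\<close>. For the adjacency matrix take the vector of square roots of the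
  degrees; there the degree bounds in (i) make the product of the end degrees of an edge of \<open>F\<close> at
  least \<open>(k - s) (n - k - 1)\<close>. The spectral hypotheses say that these lower bounds are attained, so all
  the estimates are equalities (\<open>mu_extremal\<close>, \<open>rho_extremal\<close>): every edge of \<open>L\<close> at a vertex
  that is not isolated in \<open>F\<close> belongs to \<open>F\<close>, and its end degrees sum to exactly \<open>c\<close>, in (i) even are
  \<open>k - s\<close> and \<open>n - k - 1\<close>.

  Hence \<open>L\<close> has a connected component, with at least one edge, in which all edges have end degrees
  of this kind (\<open>extremal_component\<close>). Along edges the degree alternates between \<open>p\<close> and
  \<open>c - p\<close>, so the component is semi-regular bipartite, or regular of degree \<open>c / 2\<close>. In complements, separate
  components become joined, so \<open>G\<close> is the join of the complement of the component with the subgraph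
  induced on the remaining vertices, and counting vertices gives the index \<open>r\<close> of the family: a semi-regular
  component leads to \<open>family_B\<close> or \<open>family_C\<close>, a regular one to \<open>family_H\<close> or \<open>family_W\<close>.

  All that is used about eigenvalues is that the largest eigenvalue of a real symmetric matrix is
  attained and bounds the Rayleigh quotient (\<open>Max_spectrum\<close>).
\<close>

section \<open>The largest eigenvalue of a symmetric matrix\<close>

text \<open>
  The constant is the sum of the absolute values of the entries, because every product of two
  coordinates is at most the squared norm; one is added to make it positive for the zero matrix.
\<close>

lemma quadratic_form_bounded:
  fixes A :: "real mat"
  assumes A: "A \<in> carrier_mat n n"
  shows "\<exists>C>0. \<forall>x\<in>carrier_vec n. \<bar>x \<bullet> (A *\<^sub>v x)\<bar> \<le> C * (x \<bullet> x)"
proof -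
  define C where "C = (\<Sum>i<n. \<Sum>j<n. \<bar>A $$ (i,j)\<bar>) + 1"
  have "0 \<le> (\<Sum>i<n. \<Sum>j<n. \<bar>A $$ (i,j)\<bar>)" by (intro sum_nonneg) auto
  then have C: "C > 0" by (simp add: C_def)
  have "\<bar>x \<bullet> (A *\<^sub>v x)\<bar> \<le> C * (x \<bullet> x)" if x: "x \<in> carrier_vec n" for x
  proof -
    have xx: "x \<bullet> x = (\<Sum>i<n. (x $ i)\<^sup>2)"
      using x by (simp add: scalar_prod_def power2_eq_square lessThan_atLeast0)
    have le: "(x $ i)\<^sup>2 \<le> x \<bullet> x" if "i < n" for i
      unfolding xx using that by (intro member_le_sum) auto
    have prod: "\<bar>x $ i * x $ j\<bar> \<le> x \<bullet> x" if "i < n" "j < n" for i j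
    proof -
      have "0 \<le> (\<bar>x $ i\<bar> - \<bar>x $ j\<bar>)\<^sup>2" by simp
      then have "2 * \<bar>x $ i * x $ j\<bar> \<le> (x $ i)\<^sup>2 + (x $ j)\<^sup>2"
        by (simp add: power2_eq_square algebra_simps abs_mult)
      then show ?thesis using le[OF that(1)] le[OF that(2)] by linarith
    qed
    have "x \<bullet> (A *\<^sub>v x) = (\<Sum>i<n. \<Sum>j<n. A $$ (i,j) * (x $ i * x $ j))"
      using x A by (simp add: scalar_prod_def lessThan_atLeast0 sum_distrib_left mult_ac)
    also have "\<bar>\<dots>\<bar> \<le> (\<Sum>i<n. \<bar>\<Sum>j<n. A $$ (i,j) * (x $ i * x $ j)\<bar>)" by (rule sum_abs)
    also have "\<dots> \<le> (\<Sum>i<n. \<Sum>j<n. \<bar>A $$ (i,j) * (x $ i * x $ j)\<bar>)"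
      by (intro sum_mono sum_abs)
    also have "\<dots> \<le> (\<Sum>i<n. \<Sum>j<n. \<bar>A $$ (i,j)\<bar> * (x \<bullet> x))"
      unfolding abs_mult[of "A $$ _"] by (intro sum_mono mult_left_mono prod) auto
    also have "\<dots> = (\<Sum>i<n. \<Sum>j<n. \<bar>A $$ (i,j)\<bar>) * (x \<bullet> x)"
      by (simp add: sum_distrib_right)
    also have "\<dots> \<le> C * (x \<bullet> x)"
      unfolding C_def xx by (intro mult_right_mono sum_nonneg) auto
    finally show ?thesis .
  qed
  then show ?thesis using C by blast
qed

lemma norm_mult_bounded:
  fixes A :: "real mat"
  assumes A: "A \<in> carrier_mat n n"
  shows "\<exists>C>0. \<forall>x\<in>carrier_vec n. (A *\<^sub>v x) \<bullet> (A *\<^sub>v x) \<le> C * (x \<bullet> x)"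
proof -
  have AA: "transpose_mat A * A \<in> carrier_mat n n" using A by simp
  obtain C where C: "C > 0"
    "\<And>x. x \<in> carrier_vec n \<Longrightarrow> \<bar>x \<bullet> ((transpose_mat A * A) *\<^sub>v x)\<bar> \<le> C * (x \<bullet> x)"
    using quadratic_form_bounded[OF AA] by blast
  have "(A *\<^sub>v x) \<bullet> (A *\<^sub>v x) \<le> C * (x \<bullet> x)" if x: "x \<in> carrier_vec n" for x
  proof -
    have "x \<bullet> ((transpose_mat A * A) *\<^sub>v x) = x \<bullet> (transpose_mat A *\<^sub>v (A *\<^sub>v x))"
      using A x by (simp add: assoc_mult_mat_vec[of _ n n _ n])
    also have "\<dots> = (transpose_mat A *\<^sub>v (A *\<^sub>v x)) \<bullet> x"
      using A x by (intro comm_scalar_prod[of _ n]) auto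
    also have "\<dots> = (A *\<^sub>v x) \<bullet> (A *\<^sub>v x)"
      using A x by (intro transpose_vec_mult_scalar[of _ n n]) auto
    finally show ?thesis using C(2)[OF x] by linarith
  qed
  then show ?thesis using C(1) by blast
qed

text \<open>
  For a negative semidefinite form, a vector at which the form is nearly zero is nearly in the kernel.
  Put \<open>y = M x\<close> and expand the form at \<open>x + t y\<close>: it is nonpositive for every \<open>t\<close>, and its linear coefficient
  is twice the squared norm of \<open>y\<close>. The choice \<open>t = 1 / C\<close>, with \<open>C\<close> a bound for the form, gives the claim.
\<close>

lemma semidefinite_norm_bound:
  fixes M :: "real mat"
  assumes M: "M \<in> carrier_mat n n" and sym: "transpose_mat M = M"
    and neg: "\<And>x. x \<in> carrier_vec n \<Longrightarrow> x \<bullet> (M *\<^sub>v x) \<le> 0"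
  shows "\<exists>C>0. \<forall>x\<in>carrier_vec n. (M *\<^sub>v x) \<bullet> (M *\<^sub>v x) \<le> - C * (x \<bullet> (M *\<^sub>v x))"
proof -
  obtain C where C: "C > 0" "\<And>x. x \<in> carrier_vec n \<Longrightarrow> \<bar>x \<bullet> (M *\<^sub>v x)\<bar> \<le> C * (x \<bullet> x)"
    using quadratic_form_bounded[OF M] by blast
  have "(M *\<^sub>v x) \<bullet> (M *\<^sub>v x) \<le> - C * (x \<bullet> (M *\<^sub>v x))" if x: "x \<in> carrier_vec n" for x
  proof -
    define y where "y = M *\<^sub>v x"
    have y: "y \<in> carrier_vec n" using M x by (simp add: y_def)
    define t where "t = 1 / C"
    have My: "M *\<^sub>v y \<in> carrier_vec n" using M y by simp
    have xMy: "x \<bullet> (M *\<^sub>v y) = y \<bullet> y"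
    proof -
      have "x \<bullet> (M *\<^sub>v y) = (transpose_mat M *\<^sub>v y) \<bullet> x"
        using comm_scalar_prod[OF x My] sym by simp
      also have "\<dots> = y \<bullet> (M *\<^sub>v x)" using M x y by (intro transpose_vec_mult_scalar) auto
      finally show ?thesis by (simp add: y_def)
    qed
    have "(x + t \<cdot>\<^sub>v y) \<bullet> (M *\<^sub>v (x + t \<cdot>\<^sub>v y)) = (x + t \<cdot>\<^sub>v y) \<bullet> (y + t \<cdot>\<^sub>v (M *\<^sub>v y))"
      using M x y by (simp add: mult_add_distrib_mat_vec[of _ n n] mult_mat_vec[of _ n n] y_def)
    also have "\<dots> = x \<bullet> y + t * (x \<bullet> (M *\<^sub>v y)) + (t * (y \<bullet> y) + t * (t * (y \<bullet> (M *\<^sub>v y))))"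
      using x y My by (simp add: add_scalar_prod_distrib[of _ n] scalar_prod_add_distrib[of _ n])
    finally have "x \<bullet> y + 2 * t * (y \<bullet> y) + t * t * (y \<bullet> (M *\<^sub>v y)) \<le> 0"
      using neg[of "x + t \<cdot>\<^sub>v y"] x y by (simp add: xMy algebra_simps)
    moreover have "t * t * (y \<bullet> (M *\<^sub>v y)) \<ge> - t * (y \<bullet> y)"
    proof -
      have "- C * (y \<bullet> y) \<le> y \<bullet> (M *\<^sub>v y)" using C(2)[OF y] by linarith
      then have "t * t * (- C * (y \<bullet> y)) \<le> t * t * (y \<bullet> (M *\<^sub>v y))"
        by (intro mult_left_mono) auto
      then show ?thesis using C(1) by (simp add: t_def)
    qed
    ultimately have "x \<bullet> y + t * (y \<bullet> y) \<le> 0" by (simp add: algebra_simps)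
    then show ?thesis using C(1) by (simp add: t_def field_simps y_def)
  qed
  then show ?thesis using C(1) by blast
qed

lemma scalar_prod_self_nonneg: "0 \<le> x \<bullet> (x :: real vec)"
  by (simp add: scalar_prod_def sum_nonneg)

lemma scalar_prod_self_pos:
  assumes "x \<in> carrier_vec n" "x \<noteq> 0\<^sub>v n" shows "0 < x \<bullet> (x :: real vec)"
proof -
  obtain i where i: "i < n" "x $ i \<noteq> 0" using assms by (metis eq_vecI carrier_vecD index_zero_vec)
  then have "0 < x $ i * x $ i" by (metis not_real_square_gt_zero)
  then show ?thesis using assms i unfolding scalar_prod_def by (intro sum_pos2[of _ i]) auto
qed

text \<open>
  The eigenvalue is the supremum \<open>l\<close> of the form on the unit sphere. If it were no
  eigenvalue, \<open>M = A - l I\<close> would be invertible; being negative semidefinite, it would satisfy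
  \<open>\<bar>x\<bar>\<^sup>2 \<le> C2 \<bar>M x\<bar>\<^sup>2 \<le> - C1 C2 (x \<bullet> M x)\<close>, so that already \<open>l - 1 / (C1 C2)\<close> would bound the form on the
  sphere.
\<close>

lemma ex_top_eigenvalue:
  fixes A :: "real mat"
  assumes A: "A \<in> carrier_mat n n" and sym: "transpose_mat A = A" and n: "n > 0"
  shows "\<exists>l\<in>spectrum A. \<forall>x\<in>carrier_vec n. x \<bullet> (A *\<^sub>v x) \<le> l * (x \<bullet> x)"
proof -
  define S where "S = {x \<bullet> (A *\<^sub>v x) | x. x \<in> carrier_vec n \<and> x \<bullet> x = 1}"
  define l where "l = Sup S"
  obtain C where C: "\<And>x. x \<in> carrier_vec n \<Longrightarrow> \<bar>x \<bullet> (A *\<^sub>v x)\<bar> \<le> C * (x \<bullet> x)"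
    using quadratic_form_bounded[OF A] by blast
  have "y \<le> C" if "y \<in> S" for y using C that by (fastforce simp: S_def)
  then have bdd: "bdd_above S" by (rule bdd_aboveI)
  have "unit_vec n 0 \<bullet> (A *\<^sub>v unit_vec n 0) \<in> S"
    unfolding S_def using n by (auto intro!: exI[of _ "unit_vec n 0"])
  then have ne: "S \<noteq> {}" by blast
  \<comment> \<open>By homogeneity a bound on the unit sphere is a bound everywhere.\<close>
  have scale: "x \<bullet> (A *\<^sub>v x) \<le> m * (x \<bullet> x)" if m: "\<And>y. y \<in> S \<Longrightarrow> y \<le> m" and x: "x \<in> carrier_vec n" for m x
  proof (cases "x = 0\<^sub>v n")
    case True
    then show ?thesis using A by simp
  next
    case False
    define c where "c = 1 / sqrt (x \<bullet> x)"
    have pos: "0 < x \<bullet> x" using scalar_prod_self_pos[OF x False] .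
    then have cc: "c * c * (x \<bullet> x) = 1" by (simp add: c_def)
    have "(c \<cdot>\<^sub>v x) \<bullet> (A *\<^sub>v (c \<cdot>\<^sub>v x)) \<in> S"
      unfolding S_def using x cc by (auto intro!: exI[of _ "c \<cdot>\<^sub>v x"])
    moreover have "(c \<cdot>\<^sub>v x) \<bullet> (A *\<^sub>v (c \<cdot>\<^sub>v x)) = c * c * (x \<bullet> (A *\<^sub>v x))"
      using A x by (simp add: mult_mat_vec[of _ n n])
    ultimately have "c * c * (x \<bullet> (A *\<^sub>v x)) \<le> m" using m by metis
    then show ?thesis using pos by (simp add: c_def field_simps)
  qed
  have top: "x \<bullet> (A *\<^sub>v x) \<le> l * (x \<bullet> x)" if "x \<in> carrier_vec n" for x
    unfolding l_def using cSup_upper[OF _ bdd] that by (rule scale)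
  have "eigenvalue A l"
  proof (rule ccontr)
    assume no: "\<not> eigenvalue A l"
    define M where "M = char_matrix A l"
    have M: "M \<in> carrier_mat n n" using A by (simp add: M_def)
    have symM: "transpose_mat M = M"
    proof (rule eq_matI)
      fix i j assume "i < dim_row M" "j < dim_col M"
      moreover have "A $$ (j, i) = A $$ (i, j)" if "i < n" "j < n"
        using that A by (metis sym index_transpose_mat(1) carrier_matD)
      ultimately show "transpose_mat M $$ (i, j) = M $$ (i, j)"
        using A M by (auto simp: M_def char_matrix_def)
    qed (use M in auto)
    have form: "x \<bullet> (M *\<^sub>v x) = x \<bullet> (A *\<^sub>v x) - l * (x \<bullet> x)" if x: "x \<in> carrier_vec n" for x
    proof -
      have "M *\<^sub>v x = A *\<^sub>v x + (- l) \<cdot>\<^sub>v x"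
        unfolding M_def char_matrix_def
        by (rule eq_vecI, insert x A, auto simp: add_scalar_prod_distrib[of _ n])
      then show ?thesis using A x by (simp add: scalar_prod_add_distrib[of _ n])
    qed
    have "det M \<noteq> 0"
      using no det_0_iff_vec_prod_zero_field[OF M]
      unfolding eigenvalue_char_matrix[OF A] M_def by blast
    from det_non_zero_imp_unit[OF M this, of "()"] obtain N
      where N: "N \<in> carrier_mat n n" "N * M = 1\<^sub>m n"
      unfolding Units_def ring_mat_def by auto
    obtain C1 where C1: "C1 > 0" "\<And>x. x \<in> carrier_vec n \<Longrightarrow> (M *\<^sub>v x) \<bullet> (M *\<^sub>v x) \<le> - C1 * (x \<bullet> (M *\<^sub>v x))"
      using semidefinite_norm_bound[OF M symM] top form by force
    obtain C2 where C2: "C2 > 0" "\<And>x. x \<in> carrier_vec n \<Longrightarrow> (N *\<^sub>v x) \<bullet> (N *\<^sub>v x) \<le> C2 * (x \<bullet> x)"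
      using norm_mult_bounded[OF N(1)] by blast
    have "x \<bullet> (A *\<^sub>v x) \<le> (l - 1 / (C2 * C1)) * (x \<bullet> x)" if x: "x \<in> carrier_vec n" for x
    proof -
      have "N *\<^sub>v (M *\<^sub>v x) = x"
        using assoc_mult_mat_vec[OF N(1) M x] N(2) x by simp
      then have "x \<bullet> x \<le> C2 * ((M *\<^sub>v x) \<bullet> (M *\<^sub>v x))"
        using C2(2)[of "M *\<^sub>v x"] M x by simp
      also have "\<dots> \<le> C2 * (- C1 * (x \<bullet> (M *\<^sub>v x)))"
        using C1(2)[OF x] C2(1) by (intro mult_left_mono) auto
      finally have "x \<bullet> x \<le> C2 * C1 * (l * (x \<bullet> x) - x \<bullet> (A *\<^sub>v x))"
        unfolding form[OF x] by (simp add: algebra_simps)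
      then show ?thesis using C1(1) C2(1) by (simp add: field_simps)
    qed
    then have "y \<le> l - 1 / (C2 * C1)" if "y \<in> S" for y
      using that by (fastforce simp: S_def)
    then have "l \<le> l - 1 / (C2 * C1)" unfolding l_def by (intro cSup_least ne)
    moreover have "0 < 1 / (C2 * C1)" using C1(1) C2(1) by simp
    ultimately show False by linarith
  qed
  then show ?thesis using top by (auto simp: spectrum_def)
qed

lemma Max_spectrum:
  fixes A :: "real mat"
  assumes A: "A \<in> carrier_mat n n" and sym: "transpose_mat A = A" and n: "n > 0"
  shows "eigenvalue A (Max (spectrum A))"
    and "x \<in> carrier_vec n \<Longrightarrow> x \<bullet> (A *\<^sub>v x) \<le> Max (spectrum A) * (x \<bullet> x)"
proof -
  obtain l where l: "l \<in> spectrum A" "\<And>x. x \<in> carrier_vec n \<Longrightarrow> x \<bullet> (A *\<^sub>v x) \<le> l * (x \<bullet> x)"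
    using ex_top_eigenvalue[OF assms] by blast
  note fin = card_finite_spectrum(1)[OF A]
  show "eigenvalue A (Max (spectrum A))"
    using Max_in[OF fin] l(1) by (auto simp: spectrum_def)
  show "x \<bullet> (A *\<^sub>v x) \<le> Max (spectrum A) * (x \<bullet> x)" if x: "x \<in> carrier_vec n"
    using l(2)[OF x] Max_ge[OF fin l(1)] scalar_prod_self_nonneg[of x]
    by (meson mult_right_mono order_trans)
qed

section \<open>Degrees, joins and components\<close>

lemma pair_graph_iff:
  "pair_graph G \<longleftrightarrow> finite (pverts G) \<and> parcs G \<subseteq> pverts G \<times> pverts G \<and>
     (\<forall>u v. (u, v) \<in> parcs G \<longrightarrow> (v, u) \<in> parcs G) \<and> (\<forall>v. (v, v) \<notin> parcs G)"
  (is "_ \<longleftrightarrow> ?R")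
proof
  assume "pair_graph G"
  then interpret pair_graph G .
  have "sym (parcs G)" using pair_sym_arcs by (simp add: symmetric_def)
  moreover have "parcs G \<subseteq> pverts G \<times> pverts G" by (auto dest: in_arcsD1 in_arcsD2)
  ultimately show ?R using pair_finite_verts no_loops' by (blast dest: symD)
next
  assume R: ?R
  then have sub: "parcs G \<subseteq> pverts G \<times> pverts G" and fin: "finite (pverts G)"
    and loop: "\<And>v. (v, v) \<notin> parcs G" by blast+
  have "finite (parcs G)" by (rule finite_subset[OF sub]) (simp add: fin)
  moreover have "sym (parcs G)" using R by (blast intro: symI)
  ultimately show "pair_graph G"
    using sub fin loop by unfold_locales (auto simp: symmetric_def)
qed

lemma pair_graphD:
  assumes "pair_graph G"
  shows "finite (pverts G)" "finite (parcs G)"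
    and "(u, v) \<in> parcs G \<Longrightarrow> u \<in> pverts G" "(u, v) \<in> parcs G \<Longrightarrow> v \<in> pverts G"
    and "(u, v) \<in> parcs G \<Longrightarrow> (v, u) \<in> parcs G" "(v, v) \<notin> parcs G"
proof -
  interpret pair_graph G by fact
  show "finite (pverts G)" "finite (parcs G)" "(v, v) \<notin> parcs G"
    using pair_finite_verts pair_finite_arcs no_loops' by auto
  show "(u, v) \<in> parcs G \<Longrightarrow> u \<in> pverts G" "(u, v) \<in> parcs G \<Longrightarrow> v \<in> pverts G"
    by (auto dest: in_arcsD1 in_arcsD2)
  show "(u, v) \<in> parcs G \<Longrightarrow> (v, u) \<in> parcs G"
    using assms unfolding pair_graph_iff by blast
qed

lemmas arc_vertsD = pair_graphD(3,4)[rotated]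

lemma vdeg_eq_card: "vdeg G v = card {u. (v, u) \<in> parcs G}"
proof -
  have "{e \<in> parcs G. fst e = v} = Pair v ` {u. (v, u) \<in> parcs G}" by force
  then show ?thesis
    by (simp add: vdeg_def out_degree_def out_arcs_def card_image inj_on_def)
qed

lemma neighbours_finite: "pair_graph G \<Longrightarrow> finite {u. (v, u) \<in> parcs G}"
  by (rule finite_subset[of _ "pverts G"]) (auto simp: pair_graphD(1) dest: arc_vertsD)

lemma vdeg_pos_iff: "pair_graph G \<Longrightarrow> 0 < vdeg G v \<longleftrightarrow> (\<exists>u. (v, u) \<in> parcs G)"
  using neighbours_finite[of G v] by (auto simp: vdeg_eq_card card_gt_0_iff)

lemma vdeg_less_card:
  assumes "pair_graph G" "v \<in> pverts G"
  shows "vdeg G v < card (pverts G)"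
proof -
  have "{u. (v, u) \<in> parcs G} \<subseteq> pverts G - {v}"
    using assms by (auto simp: pair_graphD(6) dest: arc_vertsD)
  then have "{u. (v, u) \<in> parcs G} \<subset> pverts G" using assms(2) by blast
  then show ?thesis
    unfolding vdeg_eq_card using assms by (intro psubset_card_mono pair_graphD(1))
qed

lemma pair_graph_complement: "pair_graph G \<Longrightarrow> pair_graph (graph_complement G)"
  unfolding pair_graph_iff graph_complement_def by (simp; blast)

lemma pverts_complement [simp]: "pverts (graph_complement G) = pverts G"
  by (simp add: graph_complement_def)

lemma vdeg_complement:
  assumes "pair_graph G" "v \<in> pverts G"
  shows "int (vdeg (graph_complement G) v) = int (card (pverts G)) - 1 - int (vdeg G v)"
proof -
  have "{u. (v, u) \<in> parcs (graph_complement G)} = pverts G - {v} - {u. (v, u) \<in> parcs G}"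
    using assms(2) by (auto simp: graph_complement_def)
  moreover have "card (pverts G - {v} - {u. (v, u) \<in> parcs G})
      = card (pverts G - {v}) - card {u. (v, u) \<in> parcs G}"
    using assms by (intro card_Diff_subset neighbours_finite) (auto simp: pair_graphD(6) dest: arc_vertsD)
  moreover have "card (pverts G - {v}) = card (pverts G) - 1"
    using assms by (simp add: pair_graphD(1))
  ultimately show ?thesis
    using vdeg_less_card[OF assms] unfolding vdeg_eq_card by simp
qed

definition induced :: "'a pair_pre_digraph \<Rightarrow> 'a set \<Rightarrow> 'a pair_pre_digraph" where
  "induced G S = \<lparr> pverts = S, parcs = parcs G \<inter> S \<times> S \<rparr>"

lemma pverts_induced [simp]: "pverts (induced G S) = S"
  by (simp add: induced_def)

lemma pair_graph_induced: "pair_graph G \<Longrightarrow> S \<subseteq> pverts G \<Longrightarrow> pair_graph (induced G S)"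
  unfolding pair_graph_iff induced_def by (simp; blast intro: finite_subset)

lemma complement_induced: 
  "S \<subseteq> pverts G \<Longrightarrow> graph_complement (induced G S) = induced (graph_complement G) S"
  by (auto simp: graph_complement_def induced_def)

definition adjacency_closed :: "'a pair_pre_digraph \<Rightarrow> 'a set \<Rightarrow> bool" where
  "adjacency_closed G S \<longleftrightarrow> (\<forall>u v. u \<in> S \<longrightarrow> (u, v) \<in> parcs G \<longrightarrow> v \<in> S)"

lemma adjacency_closedD: "adjacency_closed G S \<Longrightarrow> u \<in> S \<Longrightarrow> (u, v) \<in> parcs G \<Longrightarrow> v \<in> S"
  unfolding adjacency_closed_def by blast

lemma vdeg_induced:
  assumes "adjacency_closed G S" "v \<in> S"
  shows "vdeg (induced G S) v = vdeg G v"
proof -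
  have "{u. (v, u) \<in> parcs (induced G S)} = {u. (v, u) \<in> parcs G}"
    using assms by (auto simp: induced_def dest: adjacency_closedD)
  then show ?thesis by (simp add: vdeg_eq_card)
qed

text \<open>
  A union of components of the complement is completely joined, in \<open>G\<close>, to all other vertices.
\<close>

lemma join_of_complement_closed:
  assumes G: "pair_graph G" and S: "S \<subseteq> pverts G" "adjacency_closed (graph_complement G) S"
  shows "G = graph_join (graph_complement (induced (graph_complement G) S)) (induced G (pverts G - S))"
proof -
  have adj: "(u, v) \<in> parcs G \<and> (v, u) \<in> parcs G" if "u \<in> S" "v \<in> pverts G - S" for u v
  proof -
    have "(u, v) \<notin> parcs (graph_complement G)"
      using that adjacency_closedD[OF S(2)] by blast
    then have "(u, v) \<in> parcs G" using that S(1) by (auto simp: graph_complement_def)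
    then show ?thesis using pair_graphD(5)[OF G] by blast
  qed
  let ?J = "graph_join (graph_complement (induced (graph_complement G) S)) (induced G (pverts G - S))"
  have "(u, v) \<in> parcs G \<longleftrightarrow> (u, v) \<in> parcs ?J" for u v
  proof (cases "u \<in> pverts G \<and> v \<in> pverts G")
    case True
    then show ?thesis
      using adj[of u v] adj[of v u] pair_graphD(6)[OF G]
      by (auto simp: graph_join_def graph_complement_def induced_def)
  next
    case False
    then have "(u, v) \<notin> parcs G" by (meson G pair_graphD(3,4))
    then show ?thesis
      using False S(1) by (auto simp: graph_join_def graph_complement_def induced_def)
  qed
  then have "parcs G = parcs ?J" by auto
  then show ?thesis using S by (intro pair_pre_digraph.equality) (auto simp: graph_join_def)
qed

lemma in_upto_isoI:
  assumes "pair_graph G" "G \<in> F" shows "in_upto_iso G F"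
proof -
  interpret pair_graph G by fact
  let ?id = "\<lparr>iso_verts = id, iso_arcs = id, iso_head = snd, iso_tail = fst\<rparr>"
  have "digraph_isomorphism ?id"
    unfolding digraph_isomorphism_def using wf_digraph by simp
  moreover have "with_proj G = app_iso ?id (with_proj G)" by (simp add: app_iso_def with_proj_def)
  ultimately have "graph_iso G G" unfolding digraph_iso_def by blast
  then show ?thesis unfolding in_upto_iso_def using assms(2) by blast
qed

lemma spanning_subgraph_of_K_card:
  fixes H :: "'a pair_pre_digraph"
  assumes H: "pair_graph H" "int (card (pverts H)) = m"
  shows "spanning_subgraph_of_K m H"
proof -
  define K where "K = \<lparr> pverts = pverts H, parcs = {(u,v). (u,v) \<in> pverts H \<times> pverts H \<and> u \<noteq> v} \<rparr>"
  have K: "complete_digraph (nat m) (with_proj K)"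
    unfolding complete_digraph_pair_def using H by (auto simp: K_def pair_graphD(1))
  have "pair_wf_digraph K" by unfold_locales (auto simp: K_def)
  moreover have "pair_wf_digraph H" using H(1) by unfold_locales (auto dest: arc_vertsD)
  ultimately have "spanning (with_proj H) (with_proj K)"
    unfolding spanning_def subgraph_def
    using H(1) by (auto simp: K_def compatible_def wf_digraph_wp_iff pair_graphD(6) dest: arc_vertsD)
  then show ?thesis using K H by (auto simp: spanning_subgraph_of_K_def)
qed

definition component :: "'a pair_pre_digraph \<Rightarrow> 'a \<Rightarrow> 'a set" where
  "component G v = {w. (v, w) \<in> (parcs G)\<^sup>*}"

lemma component_self: "v \<in> component G v" by (simp add: component_def)

lemma component_closed: "adjacency_closed G (component G v)"
  unfolding adjacency_closed_def component_def by (blast intro: rtrancl_into_rtrancl)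

lemma component_least:
  assumes "adjacency_closed G W" "v \<in> W" shows "component G v \<subseteq> W"
proof -
  have "w \<in> W" if "(v, w) \<in> (parcs G)\<^sup>*" for w
    using that by induction (use assms in \<open>blast dest: adjacency_closedD\<close>)+
  then show ?thesis by (auto simp: component_def)
qed

lemma component_connected:
  assumes G: "pair_graph G"
  shows "connected_graph (induced G (component G v))"
proof -
  let ?S = "component G v" let ?H = "mk_symmetric (with_proj (induced G (component G v)))"
  have arcs: "parcs ?H = parcs (induced G ?S)" 
    using pair_graphD(5)[OF G] by (force simp: mk_symmetric_def induced_def)
  have verts: "pverts ?H = ?S" by (simp add: mk_symmetric_def)
  have to: "(v, w) \<in> rtrancl_on ?S (parcs (induced G ?S))" if "(v, w) \<in> (parcs G)\<^sup>*" for w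
    using that
  proof induction
    case base
    show ?case using component_self by auto
  next
    case (step y z)
    then have "y \<in> ?S" "z \<in> ?S" by (auto simp: component_def)
    then show ?case using step by (auto simp: induced_def intro: rtrancl_on_into_rtrancl_on)
  qed
  have "(parcs (induced G ?S))\<inverse> = parcs (induced G ?S)"
    using pair_graphD(5)[OF G] by (auto simp: induced_def)
  then have from_w: "(w, v) \<in> rtrancl_on ?S (parcs (induced G ?S))" if "(v, w) \<in> (parcs G)\<^sup>*" for w
    using rtrancl_on_converseI[OF to[OF that]] by simp
  have "(u, w) \<in> rtrancl_on ?S (parcs (induced G ?S))" if "u \<in> ?S" "w \<in> ?S" for u w
    using rtrancl_on_trans[OF from_w to] that by (simp add: component_def)
  then show ?thesis
    unfolding connected_graph_def connected_def strongly_connected_def reachable_def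
    using component_self[of v G] arcs verts by auto
qed

section \<open>Quadratic forms of the graph matrices\<close>

lemma vertex_list:
  assumes "pair_graph G"
  shows "distinct (vertex_list G)" "set (vertex_list G) = pverts G"
proof -
  have "\<exists>xs. distinct xs \<and> set xs = pverts G"
    using finite_distinct_list[OF pair_graphD(1)[OF assms]] by blast
  from someI_ex[OF this] show "distinct (vertex_list G)" "set (vertex_list G) = pverts G"
    by (simp_all add: vertex_list_def)
qed

lemma sum_vertex_list:
  assumes "pair_graph G"
  shows "(\<Sum>i<length (vertex_list G). f (vertex_list G ! i)) = (\<Sum>v\<in>pverts G. f v)"
  using sum.reindex_bij_betw[OF bij_betw_nth[OF vertex_list(1)[OF assms] refl refl]]
  by (simp add: vertex_list[OF assms])

lemma sum_adjacent_pairs: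
  assumes "pair_graph G"
  shows "(\<Sum>u\<in>pverts G. \<Sum>v\<in>pverts G. if (u, v) \<in> parcs G then f u v else 0)
    = (\<Sum>(u, v)\<in>parcs G. f u v)"
proof -
  have "(\<Sum>u\<in>pverts G. \<Sum>v\<in>pverts G. if (u, v) \<in> parcs G then f u v else 0)
     = (\<Sum>e\<in>pverts G \<times> pverts G. if e \<in> parcs G then case e of (u, v) \<Rightarrow> f u v else 0)"
    unfolding sum.cartesian_product by (intro sum.cong) auto
  also have "\<dots> = (\<Sum>e\<in>pverts G \<times> pverts G \<inter> parcs G. case e of (u, v) \<Rightarrow> f u v)"
    by (rule sum.inter_restrict[symmetric]) (simp add: pair_graphD(1)[OF assms])
  also have "pverts G \<times> pverts G \<inter> parcs G = parcs G"
    using assms unfolding pair_graph_iff by blast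
  finally show ?thesis .
qed

lemma sum_arcs_reverse:
  assumes "pair_graph G"
  shows "(\<Sum>(u, v)\<in>parcs G. f u v) = (\<Sum>(u, v)\<in>parcs G. f v u)"
  by (rule sum.reindex_bij_witness[of _ prod.swap prod.swap])
    (auto intro: pair_graphD(5)[OF assms])

text \<open>
  An arc sum of a function of the tail counts each vertex as often as its degree. This turns
  statements about edges into statements about degree vectors.
\<close>

lemma sum_arcs_tail:
  assumes "pair_graph G"
  shows "(\<Sum>(u, v)\<in>parcs G. f u) = (\<Sum>v\<in>pverts G. real (vdeg G v) * f v)"
proof -
  have "(\<Sum>v\<in>pverts G. if (u, v) \<in> parcs G then f u else 0) = real (vdeg G u) * f u" for u
  proof -
    have "pverts G \<inter> {v. (u, v) \<in> parcs G} = {v. (u, v) \<in> parcs G}"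
      using assms by (auto dest: arc_vertsD)
    then show ?thesis
      using pair_graphD(1)[OF assms] by (simp add: sum.If_cases vdeg_eq_card)
  qed
  then show ?thesis using sum_adjacent_pairs[OF assms, of "\<lambda>u v. f u"] by simp
qed

lemma sum_arcs_square:
  assumes "pair_graph G"
  shows "(\<Sum>(u, v)\<in>parcs G. (x u + x v)\<^sup>2)
    = 2 * ((\<Sum>v\<in>pverts G. real (vdeg G v) * (x v)\<^sup>2) + (\<Sum>(u, v)\<in>parcs G. x u * x v))"
proof -
  have "(\<Sum>(u, v)\<in>parcs G. (x u + x v)\<^sup>2)
      = (\<Sum>(u, v)\<in>parcs G. (x u)\<^sup>2) + (\<Sum>(u, v)\<in>parcs G. (x v)\<^sup>2) + 2 * (\<Sum>(u, v)\<in>parcs G. x u * x v)"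
    by (simp add: split_def power2_sum sum.distrib sum_distrib_left mult.assoc)
  then show ?thesis
    using sum_arcs_reverse[OF assms, of "\<lambda>u v. (x v)\<^sup>2"] sum_arcs_tail[OF assms, of "\<lambda>u. (x u)\<^sup>2"] by simp
qed

text \<open>
  Vectors are handled as functions on vertices, so that the enumeration of the vertices
  disappears from the quadratic forms below.
\<close>

definition vertex_vec :: "'a pair_pre_digraph \<Rightarrow> ('a \<Rightarrow> real) \<Rightarrow> real vec" where
  "vertex_vec G x = vec (length (vertex_list G)) (\<lambda>i. x (vertex_list G ! i))"

lemma vertex_vec_carrier [simp]: "vertex_vec G x \<in> carrier_vec (length (vertex_list G))"
  by (simp add: vertex_vec_def)

lemma vertex_vec_surj:
  assumes "pair_graph G" "y \<in> carrier_vec (length (vertex_list G))"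
  shows "\<exists>x. y = vertex_vec G x"
proof -
  let ?xs = "vertex_list G"
  define x where "x v = y $ (THE i. i < length ?xs \<and> ?xs ! i = v)" for v
  have "x (?xs ! i) = y $ i" if "i < length ?xs" for i
  proof -
    have "(THE j. j < length ?xs \<and> ?xs ! j = ?xs ! i) = i"
      using that nth_eq_iff_index_eq[OF vertex_list(1)[OF assms(1)]] by (intro the_equality) auto
    then show ?thesis by (simp add: x_def)
  qed
  then have "y = vertex_vec G x"
    using assms(2) by (intro eq_vecI) (auto simp: vertex_vec_def)
  then show ?thesis by blast
qed

lemma vertex_vec_norm:
  assumes "pair_graph G"
  shows "vertex_vec G x \<bullet> vertex_vec G x = (\<Sum>v\<in>pverts G. (x v)\<^sup>2)"
  unfolding sum_vertex_list[OF assms, symmetric]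
  by (simp add: vertex_vec_def scalar_prod_def power2_eq_square lessThan_atLeast0)

lemma vertex_vec_form:
  assumes G: "pair_graph G" and A: "A \<in> carrier_mat (length (vertex_list G)) (length (vertex_list G))"
    and entry: "\<And>i j. i < length (vertex_list G) \<Longrightarrow> j < length (vertex_list G) \<Longrightarrow>
      A $$ (i, j) = a (vertex_list G ! i) (vertex_list G ! j)"
  shows "vertex_vec G x \<bullet> (A *\<^sub>v vertex_vec G x)
    = (\<Sum>u\<in>pverts G. \<Sum>v\<in>pverts G. a u v * (x u * x v))"
proof -
  let ?xs = "vertex_list G" let ?n = "length ?xs"
  have "vertex_vec G x \<bullet> (A *\<^sub>v vertex_vec G x)
      = (\<Sum>i<?n. \<Sum>j<?n. a (?xs ! i) (?xs ! j) * (x (?xs ! i) * x (?xs ! j)))"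
    using A by (simp add: vertex_vec_def scalar_prod_def lessThan_atLeast0 sum_distrib_left mult_ac entry)
  also have "\<dots> = (\<Sum>i<?n. \<Sum>v\<in>pverts G. a (?xs ! i) v * (x (?xs ! i) * x v))"
    by (intro sum.cong refl sum_vertex_list[OF G, of "\<lambda>v. a (?xs ! i) v * (x (?xs ! i) * x v)" for i])
  also have "\<dots> = (\<Sum>u\<in>pverts G. \<Sum>v\<in>pverts G. a u v * (x u * x v))"
    by (rule sum_vertex_list[OF G])
  finally show ?thesis .
qed

lemma adjacency_carrier: "adjacency_matrix G \<in> carrier_mat (length (vertex_list G)) (length (vertex_list G))"
  by (simp add: adjacency_matrix_def Let_def)

lemma signless_carrier: "signless_laplacian G \<in> carrier_mat (length (vertex_list G)) (length (vertex_list G))"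
  by (simp add: signless_laplacian_def degree_matrix_def adjacency_matrix_def Let_def)

lemma adjacency_symmetric: "pair_graph G \<Longrightarrow> transpose_mat (adjacency_matrix G) = adjacency_matrix G"
  by (rule eq_matI) (auto simp: adjacency_matrix_def Let_def intro: pair_graphD(5))

lemma signless_symmetric: "pair_graph G \<Longrightarrow> transpose_mat (signless_laplacian G) = signless_laplacian G"
  by (rule eq_matI)
    (auto simp: signless_laplacian_def degree_matrix_def adjacency_matrix_def Let_def intro: pair_graphD(5))

lemma adjacency_form:
  assumes "pair_graph G"
  shows "vertex_vec G x \<bullet> (adjacency_matrix G *\<^sub>v vertex_vec G x) = (\<Sum>(u, v)\<in>parcs G. x u * x v)"
proof -
  have "vertex_vec G x \<bullet> (adjacency_matrix G *\<^sub>v vertex_vec G x)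
     = (\<Sum>u\<in>pverts G. \<Sum>v\<in>pverts G. (if (u, v) \<in> parcs G then 1 else 0) * (x u * x v))"
    by (rule vertex_vec_form[OF assms adjacency_carrier]) (simp add: adjacency_matrix_def Let_def)
  also have "\<dots> = (\<Sum>u\<in>pverts G. \<Sum>v\<in>pverts G. if (u, v) \<in> parcs G then x u * x v else 0)"
    by (intro sum.cong) auto
  finally show ?thesis using sum_adjacent_pairs[OF assms, of "\<lambda>u v. x u * x v"] by simp
qed

text \<open>
  Every edge is present as two arcs, so the arc sum is twice the usual edge sum for \<open>x\<^sup>T Q x\<close>.
\<close>

lemma signless_form:
  assumes "pair_graph G"
  shows "2 * (vertex_vec G x \<bullet> (signless_laplacian G *\<^sub>v vertex_vec G x))
    = (\<Sum>(u, v)\<in>parcs G. (x u + x v)\<^sup>2)"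
proof -
  have "vertex_vec G x \<bullet> (signless_laplacian G *\<^sub>v vertex_vec G x)
     = (\<Sum>u\<in>pverts G. \<Sum>v\<in>pverts G.
          ((if u = v then real (vdeg G u) else 0) + (if (u, v) \<in> parcs G then 1 else 0)) * (x u * x v))"
    by (rule vertex_vec_form[OF assms signless_carrier])
      (auto simp: signless_laplacian_def degree_matrix_def adjacency_matrix_def Let_def
        nth_eq_iff_index_eq[OF vertex_list(1)[OF assms]])
  also have "\<dots> = (\<Sum>u\<in>pverts G. \<Sum>v\<in>pverts G. (if u = v then real (vdeg G u) * (x u)\<^sup>2 else 0)
        + (if (u, v) \<in> parcs G then x u * x v else 0))"
    by (intro sum.cong refl) (auto simp: power2_eq_square algebra_simps)
  also have "\<dots> = (\<Sum>v\<in>pverts G. real (vdeg G v) * (x v)\<^sup>2) + (\<Sum>(u, v)\<in>parcs G. x u * x v)"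
    using sum_adjacent_pairs[OF assms, of "\<lambda>u v. x u * x v"] pair_graphD(1)[OF assms]
    by (simp add: sum.distrib)
  finally show ?thesis using sum_arcs_square[OF assms, of x] by simp
qed

lemma vertex_list_nonempty: "pair_graph G \<Longrightarrow> pverts G \<noteq> {} \<Longrightarrow> 0 < length (vertex_list G)"
  using vertex_list(2) by force

lemma rho_bounds_form:
  assumes "pair_graph G" "pverts G \<noteq> {}"
  shows "(\<Sum>(u, v)\<in>parcs G. x u * x v) \<le> graph_rho G * (\<Sum>v\<in>pverts G. (x v)\<^sup>2)"
  using Max_spectrum(2)[OF adjacency_carrier adjacency_symmetric vertex_list_nonempty vertex_vec_carrier,
      OF assms(1) assms, of x]
  by (simp add: graph_rho_def adjacency_form[OF assms(1)] vertex_vec_norm[OF assms(1)])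

lemma mu_bounds_form:
  assumes "pair_graph G" "pverts G \<noteq> {}"
  shows "(\<Sum>(u, v)\<in>parcs G. (x u + x v)\<^sup>2) \<le> 2 * graph_mu G * (\<Sum>v\<in>pverts G. (x v)\<^sup>2)"
  using Max_spectrum(2)[OF signless_carrier signless_symmetric vertex_list_nonempty vertex_vec_carrier,
      OF assms(1) assms, of x]
  by (simp add: graph_mu_def signless_form[OF assms(1), symmetric] vertex_vec_norm[OF assms(1)])

lemma mu_attained:
  assumes "pair_graph G" "pverts G \<noteq> {}"
  shows "\<exists>x. 0 < (\<Sum>v\<in>pverts G. (x v)\<^sup>2) \<and>
    (\<Sum>(u, v)\<in>parcs G. (x u + x v)\<^sup>2) = 2 * graph_mu G * (\<Sum>v\<in>pverts G. (x v)\<^sup>2)"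
proof -
  let ?n = "length (vertex_list G)"
  have "eigenvalue (signless_laplacian G) (graph_mu G)"
    unfolding graph_mu_def
    using Max_spectrum(1)[OF signless_carrier signless_symmetric vertex_list_nonempty] assms by blast
  then obtain y where y: "y \<in> carrier_vec ?n" "y \<noteq> 0\<^sub>v ?n"
      "signless_laplacian G *\<^sub>v y = graph_mu G \<cdot>\<^sub>v y"
    using signless_carrier[of G] by (auto simp: eigenvalue_def eigenvector_def)
  obtain x where x: "y = vertex_vec G x" using vertex_vec_surj[OF assms(1) y(1)] by blast
  have "0 < (\<Sum>v\<in>pverts G. (x v)\<^sup>2)"
    using scalar_prod_self_pos[OF y(1,2)] by (simp add: x vertex_vec_norm[OF assms(1)])
  moreover have "y \<bullet> (signless_laplacian G *\<^sub>v y) = graph_mu G * (y \<bullet> y)"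
    using y(1) by (simp add: y(3))
  ultimately show ?thesis
    using signless_form[OF assms(1), of x] by (auto simp: x vertex_vec_norm[OF assms(1)] intro!: exI[of _ x])
qed

text \<open>
  Extend an eigenvector of the induced subgraph by zero and use it as a test vector for the whole graph.
\<close>

lemma mu_induced_le:
  assumes G: "pair_graph G" and S: "S \<subseteq> pverts G" "S \<noteq> {}"
  shows "graph_mu (induced G S) \<le> graph_mu G"
proof -
  let ?H = "induced G S"
  have H: "pair_graph ?H" using pair_graph_induced[OF G S(1)] .
  obtain x where pos: "0 < (\<Sum>v\<in>S. (x v)\<^sup>2)"
    and x: "(\<Sum>(u, v)\<in>parcs ?H. (x u + x v)\<^sup>2) = 2 * graph_mu ?H * (\<Sum>v\<in>S. (x v)\<^sup>2)"
    using mu_attained[OF H] S(2) by auto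
  define y where "y v = (if v \<in> S then x v else 0)" for v
  have norm: "(\<Sum>v\<in>pverts G. (y v)\<^sup>2) = (\<Sum>v\<in>S. (x v)\<^sup>2)"
    using S(1) pair_graphD(1)[OF G] by (intro sum.mono_neutral_cong_right) (auto simp: y_def)
  have "2 * graph_mu ?H * (\<Sum>v\<in>S. (x v)\<^sup>2) = (\<Sum>(u, v)\<in>parcs ?H. (y u + y v)\<^sup>2)"
    unfolding x[symmetric] by (intro sum.cong refl) (auto simp: y_def induced_def)
  also have "\<dots> \<le> (\<Sum>(u, v)\<in>parcs G. (y u + y v)\<^sup>2)"
    using pair_graphD(2)[OF G] by (intro sum_mono2) (auto simp: induced_def)
  also have "\<dots> \<le> 2 * graph_mu G * (\<Sum>v\<in>S. (x v)\<^sup>2)"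
    using mu_bounds_form[OF G, of y] S norm by auto
  finally show ?thesis using pos by simp
qed

section \<open>Equality in the eigenvalue bounds\<close>

text \<open>
  The test vector is the degree vector \<open>x\<close> of \<open>F\<close>. The defect \<open>g\<close> is nonnegative on every arc of \<open>L\<close>, and its
  sum is twice the form of \<open>L\<close> at \<open>x\<close> minus \<open>2 c\<close> times the squared norm of \<open>x\<close>, hence at most zero. So \<open>g\<close> vanishes on
  every arc: on an arc outside \<open>F\<close> both ends then have \<open>F\<close>-degree zero, and on an arc of \<open>F\<close> with
  nonzero degree sum this sum is \<open>c\<close>.
\<close>

lemma mu_extremal:
  assumes L: "pair_graph L" and F: "pair_graph F" and sub: "pverts F = pverts L" "parcs F \<subseteq> parcs L"
    and heavy: "\<And>u v. (u, v) \<in> parcs F \<Longrightarrow> c \<le> real (vdeg F u) + real (vdeg F v)"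
    and mu: "graph_mu L \<le> c"
    and uv: "(u, v) \<in> parcs L" "0 < vdeg F u"
  shows "(u, v) \<in> parcs F \<and> real (vdeg F u) + real (vdeg F v) = c"
proof -
  define x where "x w = real (vdeg F w)" for w
  define g where "g e = (case e of (a, b) \<Rightarrow> (x a + x b)\<^sup>2 - (if (a, b) \<in> parcs F then c * (x a + x b) else 0))" for e
  have ne: "pverts L \<noteq> {}" using uv(1) L by (auto dest: arc_vertsD)
  have x0: "0 \<le> x w" for w by (simp add: x_def)
  have g0: "0 \<le> g e" if "e \<in> parcs L" for e
  proof -
    obtain a b where e: "e = (a, b)" by fastforce
    show ?thesis
    proof (cases "e \<in> parcs F")
      case True
      then have "c \<le> x a + x b" using heavy e by (simp add: x_def)
      then have "c * (x a + x b) \<le> (x a + x b) * (x a + x b)"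
        using x0[of a] x0[of b] by (intro mult_right_mono) auto
      then show ?thesis using True by (simp add: g_def e power2_eq_square)
    qed (simp add: g_def e)
  qed
  have "sum g (parcs L) = (\<Sum>(a, b)\<in>parcs L. (x a + x b)\<^sup>2) - (\<Sum>(a, b)\<in>parcs F. c * (x a + x b))"
  proof -
    have "(\<Sum>e\<in>parcs L. if e \<in> parcs F then case e of (a, b) \<Rightarrow> c * (x a + x b) else 0)
        = (\<Sum>(a, b)\<in>parcs F. c * (x a + x b))"
      using sub(2) sum.inter_restrict[OF pair_graphD(2)[OF L], of "\<lambda>(a, b). c * (x a + x b)" "parcs F"]
      by (simp add: Int_absorb1)
    moreover have "sum g (parcs L) = (\<Sum>(a, b)\<in>parcs L. (x a + x b)\<^sup>2)
        - (\<Sum>e\<in>parcs L. if e \<in> parcs F then case e of (a, b) \<Rightarrow> c * (x a + x b) else 0)"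
      unfolding sum_subtractf[symmetric] by (intro sum.cong) (auto simp: g_def)
    ultimately show ?thesis by simp
  qed
  also have "(\<Sum>(a, b)\<in>parcs F. c * (x a + x b)) = 2 * c * (\<Sum>w\<in>pverts L. (x w)\<^sup>2)"
  proof -
    have "(\<Sum>(a, b)\<in>parcs F. c * (x a + x b)) = c * ((\<Sum>(a, b)\<in>parcs F. x a) + (\<Sum>(a, b)\<in>parcs F. x b))"
      by (simp add: split_def sum_distrib_left sum.distrib distrib_left)
    also have "\<dots> = 2 * c * (\<Sum>(a, b)\<in>parcs F. x a)"
      using sum_arcs_reverse[OF F, of "\<lambda>a b. x b"] by simp
    also have "\<dots> = 2 * c * (\<Sum>w\<in>pverts L. (x w)\<^sup>2)"
      unfolding sum_arcs_tail[OF F] sub(1) by (simp add: x_def power2_eq_square)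
    finally show ?thesis .
  qed
  also have "(\<Sum>(a, b)\<in>parcs L. (x a + x b)\<^sup>2) \<le> 2 * c * (\<Sum>w\<in>pverts L. (x w)\<^sup>2)"
    using mu_bounds_form[OF L ne, of x] mu
    by (smt (verit, best) mult_right_mono sum_nonneg zero_le_power2)
  finally have "sum g (parcs L) \<le> 0" by simp
  then have "sum g (parcs L) = 0" using sum_nonneg[of "parcs L" g] g0 by fastforce
  then have g: "g (u, v) = 0"
    using sum_nonneg_eq_0_iff[OF pair_graphD(2)[OF L], of g] g0 uv(1) by blast
  have pos: "0 < x u + x v" using uv(2) x0[of v] by (simp add: x_def)
  have "(u, v) \<in> parcs F" using g pos by (auto simp: g_def split: if_splits)
  then show ?thesis using g pos by (simp add: g_def power2_eq_square x_def)
qed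

text \<open>
  With the square roots \<open>x\<close> of the degrees of \<open>F\<close> as test vector, the squared norm of \<open>x\<close> is the number of
  arcs of \<open>F\<close>, and the defect \<open>g\<close> is again nonnegative with nonpositive sum. Its vanishing settles all arcs
  of \<open>L\<close> whose two ends have positive \<open>F\<close>-degree. It says nothing on an arc from \<open>u\<close> to a vertex \<open>v\<close>
  isolated in \<open>F\<close>, since \<open>x v = 0\<close>. Such an arc is excluded by a perturbation: raising the value at \<open>v\<close>
  from \<open>0\<close> to \<open>e\<close> increases the form by at least \<open>2 e x u\<close> but the squared norm by only \<open>e\<^sup>2\<close>, so for small \<open>e\<close> the
  Rayleigh quotient would exceed \<open>t\<close>.
\<close>

lemma rho_extremal:
  assumes L: "pair_graph L" and F: "pair_graph F" and sub: "pverts F = pverts L" "parcs F \<subseteq> parcs L"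
    and heavy: "\<And>u v. (u, v) \<in> parcs F \<Longrightarrow> t\<^sup>2 \<le> real (vdeg F u) * real (vdeg F v)"
    and t: "0 \<le> t" and rho: "graph_rho L \<le> t"
    and uv: "(u, v) \<in> parcs L" "0 < vdeg F u"
  shows "(u, v) \<in> parcs F \<and> real (vdeg F u) * real (vdeg F v) = t\<^sup>2"
proof -
  define x where "x w = sqrt (real (vdeg F w))" for w
  define g where "g e = (case e of (a, b) \<Rightarrow> x a * x b - (if (a, b) \<in> parcs F then t else 0))" for e
  have ne: "pverts L \<noteq> {}" using uv(1) L by (auto dest: arc_vertsD)
  have form: "(\<Sum>(a, b)\<in>parcs L. y a * y b) \<le> t * (\<Sum>w\<in>pverts L. (y w)\<^sup>2)" for y
    using rho_bounds_form[OF L ne, of y] rho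
    by (smt (verit, best) mult_right_mono sum_nonneg zero_le_power2)
  have x0: "0 \<le> x w" for w by (simp add: x_def)
  have g0: "0 \<le> g e" if "e \<in> parcs L" for e
  proof -
    obtain a b where e: "e = (a, b)" by fastforce
    show ?thesis
    proof (cases "e \<in> parcs F")
      case True
      then have "t\<^sup>2 \<le> real (vdeg F a) * real (vdeg F b)" using heavy e by simp
      then have "t \<le> x a * x b"
        unfolding x_def real_sqrt_mult[symmetric] by (rule real_le_rsqrt)
      then show ?thesis using True by (simp add: g_def e)
    qed (simp add: g_def e x0)
  qed
  have norm: "(\<Sum>w\<in>pverts L. (x w)\<^sup>2) = real (card (parcs F))"
    using sum_arcs_tail[OF F, of "\<lambda>_. 1"] by (simp add: x_def sub(1) split_def)
  have "sum g (parcs L) = (\<Sum>(a, b)\<in>parcs L. x a * x b) - t * real (card (parcs F))"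
  proof -
    have "(\<Sum>e\<in>parcs L. if e \<in> parcs F then t else 0) = t * real (card (parcs F))"
      using sub(2) sum.inter_restrict[OF pair_graphD(2)[OF L], of "\<lambda>_. t" "parcs F"]
      by (simp add: Int_absorb1 mult.commute)
    moreover have "sum g (parcs L) = (\<Sum>(a, b)\<in>parcs L. x a * x b)
        - (\<Sum>e\<in>parcs L. if e \<in> parcs F then t else 0)"
      unfolding sum_subtractf[symmetric] by (intro sum.cong) (auto simp: g_def)
    ultimately show ?thesis by simp
  qed
  then have form_x: "(\<Sum>(a, b)\<in>parcs L. x a * x b) = sum g (parcs L) + t * (\<Sum>w\<in>pverts L. (x w)\<^sup>2)"
    by (simp add: norm)
  then have "sum g (parcs L) \<le> 0" using form[of x] by simp
  then have sum_g: "sum g (parcs L) = 0" using sum_nonneg[of "parcs L" g] g0 by fastforce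
  then have g: "g (u, v) = 0"
    using sum_nonneg_eq_0_iff[OF pair_graphD(2)[OF L], of g] g0 uv(1) by blast
  have xu: "0 < x u" using uv(2) by (simp add: x_def)
  show ?thesis
  proof (cases "vdeg F v = 0")
    case False
    then have pos: "0 < x u * x v" using xu by (simp add: x_def)
    then have inF: "(u, v) \<in> parcs F" using g by (auto simp: g_def split: if_splits)
    then have "x u * x v = t" using g by (simp add: g_def)
    then have "t\<^sup>2 = (x u)\<^sup>2 * (x v)\<^sup>2" by (simp add: power_mult_distrib[symmetric])
    then show ?thesis using inF by (simp add: x_def)
  next
    case True
    \<comment> \<open>Small enough that \<open>t e < 2 x u\<close>; adding one to \<open>t\<close> covers \<open>t = 0\<close>.\<close>
    define e where "e = x u / (t + 1)"
    have e: "0 < e" using xu t by (simp add: e_def)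
    define y where "y = x(v := e)"
    have xv: "x v = 0" using True by (simp add: x_def)
    have uv_ne: "u \<noteq> v" using uv(2) True by auto
    have vV: "v \<in> pverts L" using uv(1) L by (auto dest: arc_vertsD)
    have vu: "(v, u) \<in> parcs L" using pair_graphD(5)[OF L uv(1)] .
    have finL: "finite (parcs L)" by (rule pair_graphD(2)[OF L])
    have "(\<Sum>w\<in>pverts L. (y w)\<^sup>2) = (\<Sum>w\<in>pverts L. (x w)\<^sup>2 + (if w = v then e\<^sup>2 else 0))"
      by (intro sum.cong) (auto simp: y_def xv)
    then have norm_y: "(\<Sum>w\<in>pverts L. (y w)\<^sup>2) = (\<Sum>w\<in>pverts L. (x w)\<^sup>2) + e\<^sup>2"
      using pair_graphD(1)[OF L] vV by (simp add: sum.distrib)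
    have "(\<Sum>(a, b)\<in>parcs L. x a * x b) + 2 * (e * x u)
        = (\<Sum>f\<in>parcs L. (case f of (a, b) \<Rightarrow> x a * x b) + (if f = (u, v) then e * x u else 0)
             + (if f = (v, u) then e * x u else 0))"
      using finL uv(1) vu by (simp add: sum.distrib)
    also have "\<dots> \<le> (\<Sum>(a, b)\<in>parcs L. y a * y b)"
    proof (rule sum_mono)
      fix f assume f: "f \<in> parcs L"
      obtain a b where ab: "f = (a, b)" by fastforce
      then have "a \<noteq> b" using f pair_graphD(6)[OF L] by blast
      then show "(case f of (a, b) \<Rightarrow> x a * x b) + (if f = (u, v) then e * x u else 0)
          + (if f = (v, u) then e * x u else 0) \<le> (case f of (a, b) \<Rightarrow> y a * y b)"
        using ab xv uv_ne e x0 by (auto simp: y_def)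
    qed
    also have "\<dots> \<le> t * ((\<Sum>w\<in>pverts L. (x w)\<^sup>2) + e\<^sup>2)" using form[of y] norm_y by simp
    finally have "2 * (e * x u) \<le> t * e\<^sup>2" using form_x sum_g by (simp add: distrib_left)
    then have "2 * x u \<le> t * e" using e by (simp add: power2_eq_square)
    also have "\<dots> \<le> x u" using t xu by (simp add: e_def field_simps)
    finally show ?thesis using xu by simp
  qed
qed

section \<open>Components of the complement of a graph with incomplete closure\<close>

text \<open>
  Two vertices that are still nonadjacent when the closure process stops have degree sum less than \<open>n + s\<close>
  there; complementing both degrees gives the bound.
\<close>

lemma incomplete_closure:
  fixes G :: "'a pair_pre_digraph"
  assumes G: "pair_graph G" and n: "int (card (pverts G)) = n"
    and incomplete: "\<not> complete_digraph (nat n) (with_proj (degree_closure (n + s) G))"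
  obtains F where "pair_graph F" "pverts F = pverts G" "parcs F \<subseteq> parcs (graph_complement G)"
    "parcs F \<noteq> {}"
    "\<And>u v. (u, v) \<in> parcs F \<Longrightarrow> n - s - 1 \<le> int (vdeg F u) + int (vdeg F v)"
proof -
  define H where "H = degree_closure (n + s) G"
  have H_cl: "is_closure (n + s) G H"
    unfolding H_def degree_closure_def by (rule theI'[OF ex1_is_closure[OF G]])
  then have steps: "(closure_step (n + s))\<^sup>*\<^sup>* G H" by (simp add: is_closure_def)
  have H: "pair_graph H" "pverts H = pverts G" using closure_steps_pair_graph[OF steps G] by auto
  have GH: "parcs G \<subseteq> parcs H"
    using steps by (induction rule: rtranclp_induct) (auto simp: closure_step_def)
  let ?F = "graph_complement H"
  have F: "pair_graph ?F" by (rule pair_graph_complement[OF H(1)])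
  have ne: "parcs ?F \<noteq> {}"
  proof
    assume "parcs ?F = {}"
    then have "parcs H = {(u, v). (u, v) \<in> pverts H \<times> pverts H \<and> u \<noteq> v}"
      using pair_graphD(6)[OF H(1)] arc_vertsD[OF _ H(1)]
      by (fastforce simp: graph_complement_def)
    then have "complete_digraph (nat n) (with_proj H)"
      unfolding complete_digraph_pair_def using pair_graphD(1)[OF H(1)] H(2) n by auto
    then show False using incomplete by (simp add: H_def)
  qed
  have heavy: "n - s - 1 \<le> int (vdeg ?F u) + int (vdeg ?F v)" if uv: "(u, v) \<in> parcs ?F" for u v
  proof -
    have uv': "u \<in> pverts H" "v \<in> pverts H" "u \<noteq> v" "(u, v) \<notin> parcs H"
      using uv by (auto simp: graph_complement_def)
    have "\<not> n + s \<le> int (vdeg H u) + int (vdeg H v)"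
    proof
      assume "n + s \<le> int (vdeg H u) + int (vdeg H v)"
      then have "closure_step (n + s) H \<lparr> pverts = pverts H, parcs = parcs H \<union> {(u, v), (v, u)} \<rparr>"
        unfolding closure_step_def using uv' by blast
      then show False using H_cl unfolding is_closure_def by blast
    qed
    then show ?thesis
      using vdeg_complement[OF H(1) uv'(1)] vdeg_complement[OF H(1) uv'(2)] n H(2) by simp
  qed
  show thesis
    by (rule that[OF F _ _ ne heavy]) (use GH H(2) in \<open>auto simp: graph_complement_def\<close>)
qed

text \<open>
  Let \<open>W\<close> be the set of vertices not isolated in \<open>F\<close>. By the hypothesis \<open>extremal\<close>, \<open>F\<close> and \<open>L\<close> have the same edges
  at \<open>W\<close>, so \<open>W\<close> is a union of components of \<open>L\<close> on which degrees in \<open>F\<close> and in \<open>L\<close> agree; any of these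
  components will do. The predicate \<open>P\<close> stands for the condition on end degrees, which
  differs for the two spectral radii.
\<close>

lemma extremal_component:
  assumes L: "pair_graph L" and F: "pair_graph F" and sub: "pverts F = pverts L" "parcs F \<subseteq> parcs L"
    and ne: "parcs F \<noteq> {}"
    and extremal: "\<And>u v. (u, v) \<in> parcs L \<Longrightarrow> 0 < vdeg F u \<Longrightarrow>
      (u, v) \<in> parcs F \<and> P (vdeg F u) (vdeg F v)"
  obtains w where "w \<in> pverts L" "component L w \<subseteq> pverts L"
    "\<And>u. u \<in> component L w \<Longrightarrow> 0 < vdeg L u"
    "\<And>u v. u \<in> component L w \<Longrightarrow> (u, v) \<in> parcs L \<Longrightarrow> P (vdeg L u) (vdeg L v)"
proof -
  define W where "W = {v. 0 < vdeg F v}"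
  have deg: "vdeg L v = vdeg F v" if "v \<in> W" for v
  proof -
    have "{u. (v, u) \<in> parcs L} = {u. (v, u) \<in> parcs F}"
      using extremal[of v] that sub(2) unfolding W_def by blast
    then show ?thesis by (simp add: vdeg_eq_card)
  qed
  have closed: "adjacency_closed L W"
    unfolding adjacency_closed_def
  proof (intro allI impI)
    fix u v assume "u \<in> W" "(u, v) \<in> parcs L"
    then have "(u, v) \<in> parcs F" using extremal unfolding W_def by blast
    then show "v \<in> W"
      unfolding W_def using pair_graphD(5)[OF F] vdeg_pos_iff[OF F] by blast
  qed
  obtain w x where "(w, x) \<in> parcs F" using ne by auto
  then have w: "w \<in> pverts L" "w \<in> W"
    using arc_vertsD(1)[OF _ F] vdeg_pos_iff[OF F] unfolding W_def sub(1) by blast+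
  have in_W: "component L w \<subseteq> W" by (rule component_least[OF closed w(2)])
  have "adjacency_closed L (pverts L)"
    unfolding adjacency_closed_def by (blast intro: arc_vertsD(2)[OF _ L])
  then have in_L: "component L w \<subseteq> pverts L" using w(1) by (rule component_least)
  show thesis
  proof (rule that[OF w(1) in_L])
    show "0 < vdeg L u" if "u \<in> component L w" for u
      using that in_W deg W_def by auto
    show "P (vdeg L u) (vdeg L v)" if "u \<in> component L w" "(u, v) \<in> parcs L" for u v
    proof -
      have "u \<in> W" using that(1) in_W by blast
      then show ?thesis
        using extremal[OF that(2)] deg adjacency_closedD[OF closed _ that(2)]
        by (simp add: W_def)
    qed
  qed
qed

lemma semi_regular_bipartite_commute:
  "semi_regular_bipartite p q G \<longleftrightarrow> semi_regular_bipartite q p G"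
  unfolding semi_regular_bipartite_def by (metis Un_commute Int_commute)

text \<open>
  A constant degree sum on edges makes the degrees alternate along walks, so starting from \<open>w\<close> only two
  degrees occur; if they differ, the degree of a vertex tells its side of the bipartition.
\<close>

lemma semi_regular_component:
  assumes sum: "\<And>u v. u \<in> component L w \<Longrightarrow> (u, v) \<in> parcs L \<Longrightarrow> int (vdeg L u) + int (vdeg L v) = c"
    and irregular: "2 * int (vdeg L w) \<noteq> c"
  shows "semi_regular_bipartite (int (vdeg L w)) (c - int (vdeg L w)) (induced L (component L w))"
proof -
  let ?S = "component L w" let ?p = "int (vdeg L w)"
  define U where "U = {v \<in> ?S. int (vdeg L v) = ?p}"
  define V where "V = {v \<in> ?S. int (vdeg L v) = c - ?p}"
  have step: "u \<in> U \<and> v \<in> V \<or> u \<in> V \<and> v \<in> U" if u: "u \<in> U \<union> V" and uv: "(u, v) \<in> parcs L" for u v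
  proof -
    have uS: "u \<in> ?S" using u by (auto simp: U_def V_def)
    have "v \<in> ?S" by (rule adjacency_closedD[OF component_closed uS uv])
    then show ?thesis using u sum[OF uS uv] by (auto simp: U_def V_def)
  qed
  then have "adjacency_closed L (U \<union> V)" unfolding adjacency_closed_def by blast
  then have "?S \<subseteq> U \<union> V" by (rule component_least) (simp add: component_self U_def)
  then have S: "?S = U \<union> V" by (auto simp: U_def V_def)
  have disj: "U \<inter> V = {}" using irregular by (auto simp: U_def V_def)
  have arcs: "parcs (induced L ?S) \<subseteq> U \<times> V \<union> V \<times> U"
  proof (rule subrelI)
    fix u v assume "(u, v) \<in> parcs (induced L ?S)"
    then have "u \<in> U \<union> V" "(u, v) \<in> parcs L" by (simp_all add: induced_def S)
    then show "(u, v) \<in> U \<times> V \<union> V \<times> U" using step by blast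
  qed
  have deg: "int (vdeg (induced L ?S) v) = int (vdeg L v)" if "v \<in> ?S" for v
    using vdeg_induced[OF component_closed that] by simp
  have "int (vdeg (induced L ?S) u) = ?p" if "u \<in> U" for u
    using deg that by (simp add: U_def)
  moreover have "int (vdeg (induced L ?S) v) = c - ?p" if "v \<in> V" for v
    using deg that by (simp add: V_def)
  ultimately show ?thesis
    unfolding semi_regular_bipartite_def pverts_induced using S disj arcs by blast
qed

text \<open>
  Neighbourhoods lie on the opposite side, so the sides have at least \<open>q\<close> and \<open>p\<close> vertices. If there were
  exactly \<open>p + q + 1\<close> vertices, the sides would be \<open>q, p + 1\<close> or \<open>q + 1, p\<close>, and counting edges from both
  sides would give \<open>q p = (p + 1) q\<close> or \<open>(q + 1) p = p q\<close>. This is why \<open>r = 1\<close> does not occur in the families.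
\<close>

lemma semi_regular_bipartite_card:
  assumes H: "pair_graph H" and reg: "semi_regular_bipartite p q H" and pq: "1 \<le> p" "1 \<le> q"
    and ne: "pverts H \<noteq> {}"
  shows "p + q \<le> int (card (pverts H))" "int (card (pverts H)) \<noteq> p + q + 1"
proof -
  obtain U V where UV: "pverts H = U \<union> V" "U \<inter> V = {}" "parcs H \<subseteq> U \<times> V \<union> V \<times> U"
    and degU: "\<And>u. u \<in> U \<Longrightarrow> int (vdeg H u) = p" and degV: "\<And>v. v \<in> V \<Longrightarrow> int (vdeg H v) = q"
    using reg unfolding semi_regular_bipartite_def by blast
  have fin: "finite U" "finite V" using pair_graphD(1)[OF H] UV(1) by auto
  have has_nb: "\<exists>v. (u, v) \<in> parcs H" if "u \<in> pverts H" for u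
  proof -
    have "int (vdeg H u) = p \<or> int (vdeg H u) = q" using that degU degV UV(1) by blast
    then have "0 < vdeg H u" using pq by linarith
    then show ?thesis using vdeg_pos_iff[OF H] by blast
  qed
  obtain x y where "(x, y) \<in> parcs H" using ne has_nb by blast
  then obtain u v where uv: "u \<in> U" "v \<in> V" using UV(3) by blast
  have "{x. (u, x) \<in> parcs H} \<subseteq> V" using uv(1) UV(2,3) by blast
  then have "vdeg H u \<le> card V" unfolding vdeg_eq_card by (rule card_mono[OF fin(2)])
  then have pV: "p \<le> int (card V)" using degU[OF uv(1)] by linarith
  have "{x. (v, x) \<in> parcs H} \<subseteq> U" using uv(2) UV(2,3) by blast
  then have "vdeg H v \<le> card U" unfolding vdeg_eq_card by (rule card_mono[OF fin(1)])
  then have qU: "q \<le> int (card U)" using degV[OF uv(2)] by linarith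
  have card: "int (card (pverts H)) = int (card U) + int (card V)"
    using card_Un_disjoint[OF fin UV(2)] UV(1) by simp
  then show "p + q \<le> int (card (pverts H))" using pV qU by linarith
  \<comment> \<open>Both products are the number of edges, counted from the two sides.\<close>
  have count: "int (card U) * p = int (card V) * q"
  proof -
    have side: "(\<Sum>w\<in>pverts H. real (vdeg H w) * (if w \<in> X then 1 else 0)) = real (card X) * d"
      if X: "X \<subseteq> pverts H" and deg: "\<And>w. w \<in> X \<Longrightarrow> int (vdeg H w) = e" and d: "d = real_of_int e" for X d e
    proof -
      have "(\<Sum>w\<in>pverts H. real (vdeg H w) * (if w \<in> X then 1 else 0)) = (\<Sum>w\<in>X. d)"
      proof (rule sum.mono_neutral_cong_right[OF pair_graphD(1)[OF H] X])
        fix w assume w: "w \<in> X"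
        have "real (vdeg H w) = real_of_int (int (vdeg H w))" by simp
        then show "real (vdeg H w) * (if w \<in> X then 1 else 0) = d" unfolding deg[OF w] d using w by simp
      qed simp
      then show ?thesis by simp
    qed
    have "real (card U) * of_int p = (\<Sum>(x, y)\<in>parcs H. if x \<in> U then 1 else 0)"
      unfolding sum_arcs_tail[OF H, of "\<lambda>x. if x \<in> U then 1 else 0"]
      by (rule side[OF _ degU refl, symmetric]) (simp_all add: UV(1))
    also have "\<dots> = (\<Sum>(x, y)\<in>parcs H. if y \<in> U then 1 else 0)"
      by (rule sum_arcs_reverse[OF H])
    also have "\<dots> = (\<Sum>(x, y)\<in>parcs H. if x \<in> V then 1 else 0)"
    proof (rule sum.cong[OF refl])
      fix e assume e: "e \<in> parcs H"
      obtain x y where xy: "e = (x, y)" by fastforce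
      have "y \<in> U \<longleftrightarrow> x \<in> V" using e xy UV(2,3) by blast
      then show "(case e of (x, y) \<Rightarrow> if y \<in> U then 1 else 0) = (case e of (x, y) \<Rightarrow> if x \<in> V then 1 else (0::real))"
        by (simp add: xy)
    qed
    also have "\<dots> = real (card V) * of_int q"
      unfolding sum_arcs_tail[OF H, of "\<lambda>x. if x \<in> V then 1 else 0"]
      by (rule side[OF _ degV refl]) (simp_all add: UV(1))
    finally have "real_of_int (int (card U) * p) = real_of_int (int (card V) * q)" by simp
    then show ?thesis by (simp only: of_int_eq_iff)
  qed
  show "int (card (pverts H)) \<noteq> p + q + 1"
  proof
    assume "int (card (pverts H)) = p + q + 1"
    then consider "int (card U) = q" "int (card V) = p + 1" | "int (card U) = q + 1" "int (card V) = p"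
      using card pV qU by linarith
    then show False using count pq by cases (auto simp: algebra_simps)
  qed
qed

text \<open>
  The common core of membership in \<open>family_B\<close> and \<open>family_C\<close>: \<open>r\<close> is the excess of the component over its
  minimal size \<open>n - s - 1\<close>, and the remaining \<open>s + 1 - r\<close> vertices carry the second factor of the join.
\<close>

lemma semi_regular_complement_component:
  fixes G :: "'a pair_pre_digraph"
  defines "L \<equiv> graph_complement G"
  assumes G: "pair_graph G" and w: "w \<in> pverts G" and S: "component L w \<subseteq> pverts G"
    and sum: "\<And>u v. u \<in> component L w \<Longrightarrow> (u, v) \<in> parcs L \<Longrightarrow> int (vdeg L u) + int (vdeg L v) = n - s - 1"
    and irregular: "2 * int (vdeg L w) \<noteq> n - s - 1"
    and p: "1 \<le> int (vdeg L w)" "int (vdeg L w) \<le> n - s - 2"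
    and n: "int (card (pverts G)) = n"
  obtains G1 G2 :: "'a pair_pre_digraph" and r where "G = graph_join (graph_complement G1) G2"
    "0 \<le> r" "r \<le> s + 1" "r \<noteq> 1" "pair_graph G1" "connected_graph G1"
    "semi_regular_bipartite (int (vdeg L w)) (n - s - 1 - int (vdeg L w)) G1"
    "int (card (pverts G1)) = n - s - 1 + r" "spanning_subgraph_of_K (s + 1 - r) G2"
    "pverts G1 \<inter> pverts G2 = {}"
proof -
  let ?S = "component L w" let ?p = "int (vdeg L w)"
  let ?G1 = "induced L ?S" let ?G2 = "induced G (pverts G - ?S)"
  have L: "pair_graph L" unfolding L_def by (rule pair_graph_complement[OF G])
  have G1: "pair_graph ?G1" using pair_graph_induced[OF L] S by (simp add: L_def)
  have G2: "pair_graph ?G2" by (rule pair_graph_induced[OF G]) blast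
  have reg: "semi_regular_bipartite ?p (n - s - 1 - ?p) ?G1"
    by (rule semi_regular_component[OF sum irregular])
  have ne: "pverts ?G1 \<noteq> {}" using component_self[of w L] by auto
  define r where "r = int (card ?S) - (n - s - 1)"
  have card_S: "n - s - 1 \<le> int (card ?S)" "int (card ?S) \<noteq> n - s"
    using semi_regular_bipartite_card[OF G1 reg _ _ ne] p by auto
  have "card ?S \<le> card (pverts G)" using S pair_graphD(1)[OF G] by (rule card_mono[rotated])
  moreover have "int (card (pverts G - ?S)) = n - int (card ?S)"
    using card_Diff_subset[of ?S "pverts G"] S pair_graphD(1)[OF G] n calculation
    by (simp add: finite_subset of_nat_diff)
  ultimately show thesis
    using card_S n
    by (intro that[of ?G1 ?G2 r] G1 reg component_connected[OF L] spanning_subgraph_of_K_card[OF G2]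
        join_of_complement_closed[OF G S[unfolded L_def], folded L_def] component_closed)
      (auto simp: r_def)
qed

section \<open>The graphs with extremal complement\<close>

text \<open>
  The other case of a constant degree sum on edges: the degree of \<open>w\<close> propagates along walks.
\<close>

lemma regular_component:
  assumes sum: "\<And>u v. u \<in> component L w \<Longrightarrow> (u, v) \<in> parcs L \<Longrightarrow> int (vdeg L u) + int (vdeg L v) = c"
    and regular: "2 * int (vdeg L w) = c" and v: "v \<in> component L w"
  shows "vdeg L v = vdeg L w"
proof -
  define W where "W = {v \<in> component L w. vdeg L v = vdeg L w}"
  have "x \<in> W" if u: "u \<in> W" and ux: "(u, x) \<in> parcs L" for u x
  proof -
    have uS: "u \<in> component L w" and du: "vdeg L u = vdeg L w" using u by (simp_all add: W_def)
    have "x \<in> component L w" by (rule adjacency_closedD[OF component_closed uS ux])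
    moreover have "vdeg L x = vdeg L w" using sum[OF uS ux] regular du by linarith
    ultimately show ?thesis by (simp add: W_def)
  qed
  then have "adjacency_closed L W" unfolding adjacency_closed_def by blast
  then have "component L w \<subseteq> W" by (rule component_least) (simp add: W_def component_self)
  then show ?thesis using v by (auto simp: W_def)
qed

text \<open>
  A component of degrees \<open>p\<close> and \<open>c - p\<close> with \<open>2 p \<noteq> c\<close> leads to \<open>family_C\<close>, where the smaller degree is the
  one to name. A regular component has more than \<open>c / 2\<close> vertices, which bounds the number \<open>r\<close> of
  remaining vertices as \<open>family_W\<close> requires.
\<close>

lemma incomplete_closure_mu:
  fixes G :: "'a pair_pre_digraph"
  assumes G: "pair_graph G" and n: "int (card (pverts G)) = n"
    and mu: "mu_at_most (graph_complement G) (n - s - 1)"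
    and incomplete: "\<not> complete_digraph (nat n) (with_proj (degree_closure (n + s) G))"
  shows "\<exists>r. G \<in> family_C n s r \<union> family_W n s r"
proof -
  define L where "L = graph_complement G"
  define c where "c = n - s - 1"
  have L: "pair_graph L" and vL: "pverts L = pverts G"
    unfolding L_def by (simp_all add: pair_graph_complement[OF G])
  obtain F where F: "pair_graph F" "pverts F = pverts L" "parcs F \<subseteq> parcs L" "parcs F \<noteq> {}"
    and heavy: "\<And>u v. (u, v) \<in> parcs F \<Longrightarrow> c \<le> int (vdeg F u) + int (vdeg F v)"
    by (rule incomplete_closure[OF G n incomplete, folded vL L_def c_def]) (rule that; blast)
  have ne: "pverts L \<noteq> {}" using F(4) arc_vertsD(1)[OF _ F(1)] F(2) by auto
  then have muL: "graph_mu L \<le> real_of_int c"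
    using mu by (auto simp: mu_at_most_def L_def c_def)
  have heavy_real: "real_of_int c \<le> real (vdeg F u) + real (vdeg F v)" if "(u, v) \<in> parcs F" for u v
    using heavy[OF that] by linarith
  have tight: "(u, v) \<in> parcs F \<and> int (vdeg F u) + int (vdeg F v) = c"
    if "(u, v) \<in> parcs L" "0 < vdeg F u" for u v
  proof -
    have "(u, v) \<in> parcs F \<and> real (vdeg F u) + real (vdeg F v) = real_of_int c"
      by (rule mu_extremal[OF L F(1-3) _ muL that]) (rule heavy_real)
    then show ?thesis by linarith
  qed
  obtain w where w: "w \<in> pverts L" "component L w \<subseteq> pverts L"
    and pos: "\<And>u. u \<in> component L w \<Longrightarrow> 0 < vdeg L u"
    and sum: "\<And>u v. u \<in> component L w \<Longrightarrow> (u, v) \<in> parcs L \<Longrightarrow> int (vdeg L u) + int (vdeg L v) = c"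
    by (rule extremal_component[where P = "\<lambda>a b. int a + int b = c", OF L F])
      (erule (1) tight, (rule that; blast))
  let ?S = "component L w" let ?p = "int (vdeg L w)"
  have wG: "w \<in> pverts G" and S: "?S \<subseteq> pverts G" using w vL by simp_all
  have pw: "0 < vdeg L w" by (rule pos[OF component_self])
  then obtain x where x: "(w, x) \<in> parcs L" using vdeg_pos_iff[OF L] by blast
  then have "x \<in> ?S" by (rule adjacency_closedD[OF component_closed component_self])
  then have p: "1 \<le> ?p" "?p \<le> c - 1" using pw pos[of x] sum[OF component_self x] by linarith+
  show ?thesis
  proof (cases "2 * ?p = c")
    case False
    then have irregular: "2 * ?p \<noteq> n - s - 1" and p': "1 \<le> ?p" "?p \<le> n - s - 2"
      using p by (simp_all add: c_def)
    obtain G1 G2 :: "'a pair_pre_digraph" and r where dec: "G = graph_join (graph_complement G1) G2"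
      "0 \<le> r" "r \<le> s + 1" "r \<noteq> 1" "pair_graph G1" "connected_graph G1"
      "semi_regular_bipartite ?p (n - s - 1 - ?p) G1"
      "int (card (pverts G1)) = n - s - 1 + r" "spanning_subgraph_of_K (s + 1 - r) G2"
      "pverts G1 \<inter> pverts G2 = {}"
      by (rule semi_regular_complement_component[OF G, folded L_def, OF wG S _ irregular p' n])
        (erule (1) sum[unfolded c_def], (rule that; blast))
    have "\<exists>q. 1 \<le> q \<and> of_int q \<le> (of_int (n - s - 1) / 2 :: rat) \<and>
        semi_regular_bipartite q (n - s - 1 - q) G1"
    proof -
      have half: "of_int q \<le> (of_int (n - s - 1) / 2 :: rat)" if "2 * q \<le> n - s - 1" for q
      proof -
        have "of_int (2 * q) \<le> (of_int (n - s - 1) :: rat)" using that by (simp only: of_int_le_iff)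
        then show ?thesis by simp
      qed
      show ?thesis
      proof (cases "2 * ?p \<le> c")
        case True
        then have "2 * ?p \<le> n - s - 1" by (simp only: c_def)
        then show ?thesis using half dec(7) p(1) by blast
      next
        case False
        let ?q = "n - s - 1 - ?p"
        have "semi_regular_bipartite ?q (n - s - 1 - ?q) G1"
          using semi_regular_bipartite_commute[THEN iffD1, OF dec(7)] by simp
        moreover have "2 * ?q \<le> n - s - 1" using False by (simp add: c_def)
        moreover have "1 \<le> ?q" using p(2) by (simp add: c_def)
        ultimately show ?thesis using half by blast
      qed
    qed
    then have "G \<in> family_C n s r" unfolding family_C_def using dec by blast
    then show ?thesis by blast
  next
    case True
    let ?G1 = "induced L ?S" let ?G2 = "induced G (pverts G - ?S)"
    define r where "r = n - int (card ?S)"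
    have G1: "pair_graph ?G1" by (rule pair_graph_induced[OF L w(2)])
    have G2: "pair_graph ?G2" by (rule pair_graph_induced[OF G]) blast
    have deg_S: "vdeg L v = vdeg L w" if "v \<in> ?S" for v
      by (rule regular_component[OF _ True that]) (erule (1) sum)
    have deg: "vdeg ?G1 v = vdeg L w" if "v \<in> ?S" for v
      using deg_S[OF that] vdeg_induced[OF component_closed that] by simp
    have c2: "of_nat (vdeg L w) = (of_int (n - s - 1) / 2 :: rat)"
    proof -
      have "of_int (2 * ?p) = (of_int (n - s - 1) :: rat)" using True by (simp only: c_def)
      then show ?thesis by simp
    qed
    have reg: "regular_graph (of_int (n - s - 1) / 2) ?G1"
      unfolding regular_graph_def using deg c2 by simp
    have "card ?S \<le> card (pverts G)" using S pair_graphD(1)[OF G] by (rule card_mono[rotated])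
    then have card_Z: "int (card (pverts G - ?S)) = r"
      using card_Diff_subset[of ?S "pverts G"] S pair_graphD(1)[OF G] n
      by (simp add: finite_subset of_nat_diff r_def)
    have "vdeg L w < card ?S"
      using vdeg_less_card[OF G1, of w] deg[OF component_self] by (simp add: component_self)
    then have "2 * r \<le> n + s - 1" using True by (simp add: r_def c_def)
    then have "of_int (2 * r) \<le> (of_int (n + s - 1) :: rat)" by (simp only: of_int_le_iff)
    then have r: "of_int r \<le> (of_int (n + s - 1) / 2 :: rat)" by simp
    have mu2: "mu_at_most (graph_complement ?G2) (n - s - 1)"
    proof (cases "pverts G - ?S = {}")
      case False
      have "graph_complement ?G2 = induced L (pverts G - ?S)"
        unfolding L_def by (rule complement_induced) blast
      then show ?thesis
        using mu_induced_le[OF L _ False] muL vL by (auto simp: mu_at_most_def c_def)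
    qed (simp add: mu_at_most_def)
    have "G = graph_join (graph_complement ?G1) ?G2"
      unfolding L_def
      by (rule join_of_complement_closed[OF G]) (use S component_closed[of L w] in \<open>simp_all add: L_def\<close>)
    then have "G \<in> family_W n s r"
      unfolding family_W_def
      by (intro CollectI exI[of _ ?G1] exI[of _ ?G2] conjI r G1 reg mu2 component_connected[OF L]
          spanning_subgraph_of_K_card[OF G2]) (use card_Z in \<open>auto simp: r_def\<close>)
    then show ?thesis by blast
  qed
qed

text \<open>
  \<open>a b - m N = (N - a) (N - b) + N (a + b - m - N)\<close>, and both summands are nonnegative. The bounds
  \<open>N\<close> and \<open>m + N\<close> will be \<open>n - k - 1\<close>, the largest possible degree in the complement, and \<open>n - s - 1\<close>.
\<close>

lemma product_of_bounded_degrees: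
  fixes a b m N :: int
  assumes "a \<le> N" "b \<le> N" "m + N \<le> a + b" "0 \<le> N"
  shows "m * N \<le> a * b"
    and "a * b = m * N \<Longrightarrow> 0 < N \<Longrightarrow> a = m \<and> b = N \<or> a = N \<and> b = m"
proof -
  have id: "a * b - m * N = (N - a) * (N - b) + N * (a + b - m - N)"
    by (simp add: algebra_simps)
  have nn: "0 \<le> (N - a) * (N - b)" "0 \<le> N * (a + b - m - N)" using assms by simp_all
  then show "m * N \<le> a * b" using id by linarith
  assume "a * b = m * N" "0 < N"
  then have "(N - a) * (N - b) = 0" "N * (a + b - m - N) = 0" using id nn by linarith+
  then show "a = m \<and> b = N \<or> a = N \<and> b = m" using \<open>0 < N\<close> by auto
qed

text \<open>
  Here \<open>m = k - s\<close> and \<open>N = n - k - 1\<close> are the two extreme degrees. If they differ, the component is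
  semi-regular and \<open>G\<close> lies in \<open>family_B\<close>. If they coincide then \<open>n = 2 k + 1 - s\<close>, the component is
  \<open>m\<close>-regular, hence its complement is \<open>r\<close>-regular with \<open>r\<close> determined by the number of vertices, as in \<open>family_H\<close>.
\<close>

lemma incomplete_closure_rho:
  fixes G :: "'a pair_pre_digraph"
  assumes G: "pair_graph G" and n: "int (card (pverts G)) = n"
    and bounds: "2 * k \<le> n" "2 * k + 1 - s \<le> n" "s \<le> k" "1 \<le> k"
    and delta: "k \<le> int (min_degree G)"
    and rho: "graph_rho (graph_complement G) \<le> sqrt (real_of_int ((k - s) * (n - k - 1)))"
    and incomplete: "\<not> complete_digraph (nat n) (with_proj (degree_closure (n + s) G))"
  shows "\<exists>r. G \<in> family_B n k s r \<union> family_H n k s r"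
proof -
  define L where "L = graph_complement G"
  define m where "m = k - s"
  define N where "N = n - k - 1"
  define t where "t = sqrt (real_of_int (m * N))"
  have mN: "0 \<le> m" "0 \<le> N" "m + N = n - s - 1" "m \<le> N" using bounds by (auto simp: m_def N_def)
  have t: "0 \<le> t" "t\<^sup>2 = real_of_int (m * N)" using mN by (simp_all add: t_def)
  have L: "pair_graph L" and vL: "pverts L = pverts G"
    unfolding L_def by (simp_all add: pair_graph_complement[OF G])
  obtain F where F: "pair_graph F" "pverts F = pverts L" "parcs F \<subseteq> parcs L" "parcs F \<noteq> {}"
    and heavy: "\<And>u v. (u, v) \<in> parcs F \<Longrightarrow> m + N \<le> int (vdeg F u) + int (vdeg F v)"
    by (rule incomplete_closure[OF G n incomplete, folded vL L_def mN(3)]) (rule that; blast)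
  have maxdeg: "int (vdeg F v) \<le> N" if "v \<in> pverts F" for v
  proof -
    have vG: "v \<in> pverts G" using that F(2) vL by simp
    have "min_degree G \<le> vdeg G v"
      unfolding min_degree_def using pair_graphD(1)[OF G] vG by (intro Min_le) auto
    then have "int (vdeg L v) \<le> N"
      using vdeg_complement[OF G vG] delta n by (simp add: L_def N_def)
    then show ?thesis using vdeg_mono[OF L F(3), of v] by linarith
  qed
  have prod: "real_of_int (m * N) \<le> real (vdeg F u) * real (vdeg F v)" if uv: "(u, v) \<in> parcs F" for u v
  proof -
    have "m * N \<le> int (vdeg F u) * int (vdeg F v)"
      using arc_vertsD[OF uv F(1)] by (intro product_of_bounded_degrees(1) maxdeg heavy[OF uv] mN(2))
    then have "real_of_int (m * N) \<le> real_of_int (int (vdeg F u) * int (vdeg F v))"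
      by (simp only: of_int_le_iff)
    then show ?thesis by simp
  qed
  have rhoL: "graph_rho L \<le> t" using rho by (simp add: L_def t_def m_def N_def)
  have ext: "(u, v) \<in> parcs F \<and> real (vdeg F u) * real (vdeg F v) = t\<^sup>2"
    if "(u, v) \<in> parcs L" "0 < vdeg F u" for u v
    by (rule rho_extremal[OF L F(1-3) _ t(1) rhoL that]) (use prod t(2) in simp)
  have tight: "(u, v) \<in> parcs F \<and>
      (int (vdeg F u) = m \<and> int (vdeg F v) = N \<or> int (vdeg F u) = N \<and> int (vdeg F v) = m)"
    if uv: "(u, v) \<in> parcs L" "0 < vdeg F u" for u v
  proof -
    have uvF: "(u, v) \<in> parcs F" using ext[OF uv] by blast
    have "real_of_int (int (vdeg F u) * int (vdeg F v)) = real_of_int (m * N)"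
      using ext[OF uv] t(2) by simp
    then have eq: "int (vdeg F u) * int (vdeg F v) = m * N" by (simp only: of_int_eq_iff)
    have "0 < N" using maxdeg[OF arc_vertsD(1)[OF uvF F(1)]] uv(2) by linarith
    then show ?thesis
      using product_of_bounded_degrees(2)[OF _ _ heavy[OF uvF] mN(2) eq] arc_vertsD[OF uvF F(1)] maxdeg uvF by blast
  qed
  obtain w where w: "w \<in> pverts L" "component L w \<subseteq> pverts L"
    and pos: "\<And>u. u \<in> component L w \<Longrightarrow> 0 < vdeg L u"
    and ends: "\<And>u v. u \<in> component L w \<Longrightarrow> (u, v) \<in> parcs L \<Longrightarrow>
      int (vdeg L u) = m \<and> int (vdeg L v) = N \<or> int (vdeg L u) = N \<and> int (vdeg L v) = m"
    by (rule extremal_component[where P = "\<lambda>a b. int a = m \<and> int b = N \<or> int a = N \<and> int b = m",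
          OF L F])
      (erule (1) tight, (rule that; blast))
  let ?S = "component L w" let ?p = "int (vdeg L w)"
  have wG: "w \<in> pverts G" and S: "?S \<subseteq> pverts G" using w vL by simp_all
  have nb: "\<exists>x. (u, x) \<in> parcs L" if "u \<in> ?S" for u using pos[OF that] vdeg_pos_iff[OF L] by blast
  have deg: "int (vdeg L u) = m \<or> int (vdeg L u) = N" if "u \<in> ?S" for u
    using nb[OF that] ends[OF that] by blast
  have m_pos: "1 \<le> m"
  proof -
    obtain x where x: "(w, x) \<in> parcs L" using nb[OF component_self] by blast
    then have "x \<in> ?S" by (rule adjacency_closedD[OF component_closed component_self])
    then show ?thesis using ends[OF component_self x] pos[of x] pos[OF component_self] by linarith
  qed
  show ?thesis
  proof (cases "m = N")
    case False
    have sum: "int (vdeg L u) + int (vdeg L v) = n - s - 1" if "u \<in> ?S" "(u, v) \<in> parcs L" for u v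
      using ends[OF that] mN(3) by linarith
    have pw: "?p = m \<or> ?p = N" by (rule deg[OF component_self])
    then have p: "2 * ?p \<noteq> n - s - 1" "1 \<le> ?p" "?p \<le> n - s - 2"
      using False mN m_pos by linarith+
    obtain G1 G2 :: "'a pair_pre_digraph" and r where dec: "G = graph_join (graph_complement G1) G2"
      "0 \<le> r" "r \<le> s + 1" "r \<noteq> 1" "pair_graph G1" "connected_graph G1"
      "semi_regular_bipartite ?p (n - s - 1 - ?p) G1"
      "int (card (pverts G1)) = n - s - 1 + r" "spanning_subgraph_of_K (s + 1 - r) G2"
      "pverts G1 \<inter> pverts G2 = {}"
      by (rule semi_regular_complement_component[OF G, folded L_def, OF wG S _ p n])
        (erule (1) sum, (rule that; blast))
    have "semi_regular_bipartite m N G1"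
      using pw dec(7) mN(3) semi_regular_bipartite_commute[of m N G1]
      by (metis add_diff_cancel_left' add_diff_cancel_right')
    then have "semi_regular_bipartite (k - s) (n - k - 1) G1" by (simp only: m_def N_def)
    then have "G \<in> family_B n k s r" unfolding family_B_def using dec by blast
    then show ?thesis by blast
  next
    case True
    let ?H = "induced L ?S" let ?G2 = "induced G (pverts G - ?S)"
    define r where "r = int (card ?S) - 1 - m"
    have H: "pair_graph ?H" by (rule pair_graph_induced[OF L w(2)])
    have G2: "pair_graph ?G2" by (rule pair_graph_induced[OF G]) blast
    have degH: "int (vdeg ?H v) = m" if "v \<in> ?S" for v
      using vdeg_induced[OF component_closed that] deg[OF that] True by simp
    have degC: "int (vdeg (graph_complement ?H) v) = r" if "v \<in> ?S" for v
      using vdeg_complement[OF H, of v] degH[OF that] that by (simp add: r_def)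
    have reg: "regular_graph (of_int r) (graph_complement ?H)"
      unfolding regular_graph_def
    proof
      fix v assume "v \<in> pverts (graph_complement ?H)"
      then have "of_int (int (vdeg (graph_complement ?H) v)) = (of_int r :: rat)"
        using degC by simp
      then show "of_nat (vdeg (graph_complement ?H) v) = (of_int r :: rat)" by simp
    qed
    have r0: "0 \<le> r" using degC[OF component_self] by linarith
    have card_le: "card ?S \<le> card (pverts G)" using S pair_graphD(1)[OF G] by (rule card_mono[rotated])
    then have card_Z: "int (card (pverts G - ?S)) = n - int (card ?S)"
      using card_Diff_subset[of ?S "pverts G"] S pair_graphD(1)[OF G] n
      by (simp add: finite_subset of_nat_diff)
    have nk: "n = 2 * k + 1 - s" using True by (simp add: m_def N_def)
    have "G = graph_join (graph_complement ?H) ?G2"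
      unfolding L_def
      by (rule join_of_complement_closed[OF G]) (use S component_closed[of L w] in \<open>simp_all add: L_def\<close>)
    then have "G \<in> family_H n k s r"
      unfolding family_H_def
      by (intro CollectI exI[of _ "graph_complement ?H"] exI[of _ ?G2] conjI nk r0 reg
          pair_graph_complement[OF H] spanning_subgraph_of_K_card[OF G2])
        (use bounds nk card_Z card_le n in \<open>auto simp: r_def m_def\<close>)
    then show ?thesis by blast
  qed
qed

theorem theorem1p8:
  fixes n k s :: int and G :: "'a pair_pre_digraph"
  assumes "pair_graph G"
    and "int (card (pverts G)) = n"
  shows "(n \<ge> max (2 * k) (2 * k + 1 - s) \<and> int (min_degree G) \<ge> k \<and> k \<ge> max s 1 \<and>
            graph_rho (graph_complement G) \<le> sqrt (real_of_int ((k - s) * (n - k - 1)))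
          \<longrightarrow> complete_digraph (nat n) (with_proj (degree_closure (n + s) G)) \<or>
              (\<exists>r. in_upto_iso G (family_B n k s r \<union> family_H n k s r)) \<or>
              (s = k - 1 \<and> is_star_complement_join k G))
       \<and> (n \<ge> 3 * s + 2 \<and> mu_at_most (graph_complement G) (n - s - 1)
          \<longrightarrow> complete_digraph (nat n) (with_proj (degree_closure (n + s) G)) \<or>
              (\<exists>r. in_upto_iso G (family_C n s r \<union> family_D n s r \<union> family_W n s r)))"
proof (intro conjI impI, goal_cases)
  case 1
  then have bounds: "2 * k \<le> n" "2 * k + 1 - s \<le> n" "s \<le> k" "1 \<le> k" "k \<le> int (min_degree G)"
    "graph_rho (graph_complement G) \<le> sqrt (real_of_int ((k - s) * (n - k - 1)))"
    by (simp_all only: max.bounded_iff)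
  show ?case
  proof (cases "complete_digraph (nat n) (with_proj (degree_closure (n + s) G))")
    case False
    obtain r where "G \<in> family_B n k s r \<union> family_H n k s r"
      using incomplete_closure_rho[OF assms bounds False] by (rule exE)
    then have "in_upto_iso G (family_B n k s r \<union> family_H n k s r)" by (rule in_upto_isoI[OF assms(1)])
    then show ?thesis by blast
  qed simp
next
  case 2
  then have mu: "mu_at_most (graph_complement G) (n - s - 1)" by (rule conjunct2)
  show ?case
  proof (cases "complete_digraph (nat n) (with_proj (degree_closure (n + s) G))")
    case False
    obtain r where "G \<in> family_C n s r \<union> family_W n s r"
      using incomplete_closure_mu[OF assms mu False] by (rule exE)
    then have "G \<in> family_C n s r \<union> family_D n s r \<union> family_W n s r" by blast
    then have "in_upto_iso G (family_C n s r \<union> family_D n s r \<union> family_W n s r)"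
      by (rule in_upto_isoI[OF assms(1)])
    then show ?thesis by blast
  qed simp
qed

end
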